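(* Let $\Phi$ be a Banach function space over $\mathbb{R}_+$ such that the Hardy operator $P$ is bounded on $\Phi$. Then for every interpolation couple $(X,Y)$ of Banach spaces, $[X,Y]_\Phi = (X,Y)_\Phi$.
   Context: $\mathbb{R}_+=[0,\infty)$ with Lebesgue measure. $\mathcal{M}$ is the set of (classes of) complex measurable functions on $\mathbb{R}_+$ with the topology of convergence in measure; $L^1_{loc}$ is the space of locally integrable functions on $\mathbb{R}_+$ (integrable on each $[0,\tau]$). A Banach function space (over $\mathbb{R}_+$) is a Banach space $\Phi$ that is both a Banach lattice and an order ideal of $\mathcal{M}$: $\Phi$ is a sublattice of $\mathcal{M}$, and $|f|\le|g|$, $g\in\Phi$, $f\in\mathcal{M}$ implies $f\in\Phi$ and $\|f\|_\Phi\le\|g\|_\Phi$. (No Fatou property is required.) Hardy operator: $Pf(t)=\frac1t\int_0^t f(s)\,ds$, with maximal domain $L^1_{loc}$. That $P$ is bounded on $\Phi$ means that $\Phi\subseteq L^1_{loc}$ and $P$ is a bounded operator from $\Phi$ to $\Phi$; the inclusion $\Phi\subseteq L^1_{loc}$ is then continuous. For a Banach space $Z$, $\Phi(Z)$ is the Banach space of measurable $f:\mathbb{R}_+\to Z$ with $|f|_Z\in\Phi$, with norm $\|f\|_{\Phi(Z)}=\||f|_Z\|_\Phi$. Trace method: $W^{1,\Phi}(X,Y)=\{u\in W^{1,1}_{loc}(X+Y): u\in\Phi(Y),\ \dot u\in\Phi(X)\}$ (functions on $\mathbb{R}_+$ with values in $X+Y$, locally up to $t=0$), and $[X,Y]_\Phi=\{u(0):u\in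 W^{1,\Phi}(X,Y)\}$, with norm $|x|_{[X,Y]_\Phi}=\inf\{\|u\|_{\Phi(Y)}+\|\dot u\|_{\Phi(X)}:u\in W^{1,\Phi}(X,Y),\,u(0)=x\}$. $K$-method: for $x\in X+Y$, $t>0$, $K(t,x)=\inf\{|a|_X+t|b|_Y: a\in X,\,b\in Y,\,a+b=x\}$, and $(X,Y)_\Phi=\{x\in X+Y:[t\mapsto t^{-1}K(t,x)]\in\Phi\}$ with norm $|x|_{(X,Y)_\Phi}=\|(\cdot)^{-1}K(\cdot,x)\|_\Phi$. *)

theory Defs
  imports "HOL-Analysis.Analysis"
begin

section \<open>Banach function spaces over the half line\<close>

abbreviation halfline :: "real measure" where
  "halfline \<equiv> lebesgue_on {0..}"

text \<open>
  Elements of \<open>\<M>\<close> are handled through representatives: complex functions that are Lebesgue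
  measurable on \<open>[0,\<infinity>)\<close> (their values on the negative axis are irrelevant).  A Banach function
  space is a pair \<open>(\<Phi>, N)\<close> of a set of such representatives and a norm.  The ideal property is
  required almost everywhere, so that both membership in \<open>\<Phi>\<close> and \<open>N\<close> depend only on the class
  of a function, and \<open>N f = 0\<close> means that \<open>f\<close> vanishes almost everywhere.  Closure under the
  modulus is the sublattice condition, as \<open>max f g = (f + g + \<bar>f - g\<bar>) / 2\<close> for real \<open>f\<close>, \<open>g\<close>.
\<close>

definition banach_function_space ::
    "(real \<Rightarrow> complex) set \<Rightarrow> ((real \<Rightarrow> complex) \<Rightarrow> real) \<Rightarrow> bool" where
  "banach_function_space \<Phi> N \<longleftrightarrow>
     \<Phi> \<subseteq> borel_measurable halfline \<and>
     \<comment> \<open>normed vector space\<close>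
     (\<lambda>_. 0) \<in> \<Phi> \<and>
     (\<forall>f\<in>\<Phi>. \<forall>g\<in>\<Phi>. (\<lambda>t. f t + g t) \<in> \<Phi> \<and> N (\<lambda>t. f t + g t) \<le> N f + N g) \<and>
     (\<forall>c. \<forall>f\<in>\<Phi>. (\<lambda>t. c * f t) \<in> \<Phi> \<and> N (\<lambda>t. c * f t) = cmod c * N f) \<and>
     (\<forall>f\<in>\<Phi>. 0 \<le> N f \<and> (N f = 0 \<longleftrightarrow> (AE t in halfline. f t = 0))) \<and>
     \<comment> \<open>completeness\<close>
     (\<forall>F :: nat \<Rightarrow> real \<Rightarrow> complex.
        (\<forall>n. F n \<in> \<Phi>) \<and> (\<forall>e>0. \<exists>M. \<forall>m\<ge>M. \<forall>n\<ge>M. N (\<lambda>t. F m t - F n t) < e) \<longrightarrow>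
        (\<exists>f\<in>\<Phi>. (\<lambda>n. N (\<lambda>t. F n t - f t)) \<longlonglongrightarrow> 0)) \<and>
     \<comment> \<open>sublattice and order ideal\<close>
     (\<forall>f\<in>\<Phi>. (\<lambda>t. complex_of_real (cmod (f t))) \<in> \<Phi>) \<and>
     (\<forall>g\<in>\<Phi>. \<forall>f\<in>borel_measurable halfline.
        (AE t in halfline. cmod (f t) \<le> cmod (g t)) \<longrightarrow> f \<in> \<Phi> \<and> N f \<le> N g)"

definition L1_loc :: "(real \<Rightarrow> complex) set" where
  "L1_loc = {f. \<forall>\<tau>\<ge>0. integrable (lebesgue_on {0..\<tau>}) f}"

definition hardy :: "(real \<Rightarrow> complex) \<Rightarrow> real \<Rightarrow> complex" where
  "hardy f t = (1 / t) *\<^sub>R (\<integral>s. f s \<partial>lebesgue_on {0..t})"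

definition hardy_bounded_on ::
    "(real \<Rightarrow> complex) set \<Rightarrow> ((real \<Rightarrow> complex) \<Rightarrow> real) \<Rightarrow> bool" where
  "hardy_bounded_on \<Phi> N \<longleftrightarrow>
     \<Phi> \<subseteq> L1_loc \<and> (\<forall>f\<in>\<Phi>. hardy f \<in> \<Phi>) \<and> (\<exists>C. \<forall>f\<in>\<Phi>. N (hardy f) \<le> C * N f)"


section \<open>Functions with values in a normed space\<close>

text \<open>
  The sum \<open>X + Y\<close> of a couple is a subspace of the ambient vector space that carries a norm of its
  own.  Vector-valued notions are therefore stated for a subspace \<open>S\<close> with a norm \<open>n\<close>; a space
  given as a type is the instance \<open>(UNIV, norm)\<close>.  Measurability is strong (Bochner)
  measurability.  The library's Bochner integral is restricted to second countable types;
  the integral below is its definition with the norm \<open>n\<close> and strong measurability.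
\<close>

definition strongly_measurable_in ::
    "'v::real_vector set \<Rightarrow> ('v \<Rightarrow> real) \<Rightarrow> 'a measure \<Rightarrow> ('a \<Rightarrow> 'v) \<Rightarrow> bool" where
  "strongly_measurable_in S n M f \<longleftrightarrow>
     f ` space M \<subseteq> S \<and>
     (\<exists>s :: nat \<Rightarrow> 'a \<Rightarrow> 'v. (\<forall>k. simple_function M (s k) \<and> s k ` space M \<subseteq> S) \<and>
        (AE t in M. (\<lambda>k. n (f t - s k t)) \<longlonglongrightarrow> 0))"

definition has_bochner_integral_in ::
    "'v::real_vector set \<Rightarrow> ('v \<Rightarrow> real) \<Rightarrow> 'a measure \<Rightarrow> ('a \<Rightarrow> 'v) \<Rightarrow> 'v \<Rightarrow> bool" where
  "has_bochner_integral_in S n M f z \<longleftrightarrow>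
     strongly_measurable_in S n M f \<and> z \<in> S \<and>
     (\<exists>s :: nat \<Rightarrow> 'a \<Rightarrow> 'v.
        (\<forall>k. Bochner_Integration.simple_bochner_integrable M (s k) \<and> s k ` space M \<subseteq> S) \<and>
        (\<lambda>k. \<integral>\<^sup>+t. ennreal (n (f t - s k t)) \<partial>M) \<longlonglongrightarrow> 0 \<and>
        (\<lambda>k. n (Bochner_Integration.simple_bochner_integral M (s k) - z)) \<longlonglongrightarrow> 0)"

definition locally_integrable_in ::
    "'v::real_vector set \<Rightarrow> ('v \<Rightarrow> real) \<Rightarrow> (real \<Rightarrow> 'v) \<Rightarrow> bool" where
  "locally_integrable_in S n f \<longleftrightarrow>
     strongly_measurable_in S n halfline f \<and>
     (\<forall>\<tau>\<ge>0. integrable (lebesgue_on {0..\<tau>}) (\<lambda>t. n (f t)))"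

text \<open>Test functions of class \<open>C\<^sup>1\<close> with compact support in \<open>(0,\<infinity>)\<close>, given with their derivative.\<close>

definition test_function :: "(real \<Rightarrow> real) \<Rightarrow> (real \<Rightarrow> real) \<Rightarrow> bool" where
  "test_function \<phi> \<phi>' \<longleftrightarrow>
     (\<forall>t. (\<phi> has_real_derivative \<phi>' t) (at t)) \<and> continuous_on UNIV \<phi>' \<and>
     (\<exists>a>0. \<exists>b. \<forall>t. t \<notin> {a..b} \<longrightarrow> \<phi> t = 0)"

definition weak_derivative_in ::
    "'v::real_vector set \<Rightarrow> ('v \<Rightarrow> real) \<Rightarrow> (real \<Rightarrow> 'v) \<Rightarrow> (real \<Rightarrow> 'v) \<Rightarrow> bool" where
  "weak_derivative_in S n u v \<longleftrightarrow>
     (\<forall>\<phi> \<phi>'. test_function \<phi> \<phi>' \<longrightarrow>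
        (\<exists>z. has_bochner_integral_in S n halfline (\<lambda>t. \<phi>' t *\<^sub>R u t) z \<and>
             has_bochner_integral_in S n halfline (\<lambda>t. \<phi> t *\<^sub>R v t) (- z)))"

text \<open>
  \<open>u \<in> W\<^sup>1\<^sup>,\<^sup>1\<^sub>l\<^sub>o\<^sub>c\<close>, locally up to \<open>t = 0\<close>, with derivative \<open>v\<close>.  Classes are represented by their
  unique representative that is continuous on \<open>[0,\<infinity>)\<close>, so that the trace \<open>u 0\<close> makes sense.
\<close>

definition W11_loc_in ::
    "'v::real_vector set \<Rightarrow> ('v \<Rightarrow> real) \<Rightarrow> (real \<Rightarrow> 'v) \<Rightarrow> (real \<Rightarrow> 'v) \<Rightarrow> bool" where
  "W11_loc_in S n u v \<longleftrightarrow>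
     locally_integrable_in S n u \<and> locally_integrable_in S n v \<and>
     weak_derivative_in S n u v \<and>
     (\<forall>t\<ge>0. ((\<lambda>s. n (u s - u t)) \<longlongrightarrow> 0) (at t within {0..}))"

definition bochner_space ::
    "(real \<Rightarrow> complex) set \<Rightarrow> (real \<Rightarrow> 'z::real_normed_vector) set" where
  "bochner_space \<Phi> = {f. strongly_measurable_in UNIV norm halfline f \<and>
                          (\<lambda>t. complex_of_real (norm (f t))) \<in> \<Phi>}"

definition bochner_norm ::
    "((real \<Rightarrow> complex) \<Rightarrow> real) \<Rightarrow> (real \<Rightarrow> 'z::real_normed_vector) \<Rightarrow> real" where
  "bochner_norm N f = N (\<lambda>t. complex_of_real (norm (f t)))"


section \<open>Interpolation couples\<close>

text \<open>
  A couple consists of two Banach spaces (types) \<open>'x\<close> and \<open>'y\<close> with linear continuous embeddings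
  \<open>i\<close> and \<open>j\<close> into a Hausdorff topological vector space \<open>'v\<close>.  The continuity of addition is part of
  the sort of \<open>'v\<close>, that of scalar multiplication is stated here.
\<close>

definition interpolation_couple ::
    "('x::banach \<Rightarrow> 'v::{real_vector,topological_ab_group_add,t2_space}) \<Rightarrow>
     ('y::banach \<Rightarrow> 'v) \<Rightarrow> bool" where
  "interpolation_couple i j \<longleftrightarrow>
     continuous_on UNIV (\<lambda>(c :: real, v :: 'v). c *\<^sub>R v) \<and>
     linear i \<and> inj i \<and> continuous_on UNIV i \<and>
     linear j \<and> inj j \<and> continuous_on UNIV j"

definition sum_space ::
    "('x::real_normed_vector \<Rightarrow> 'v::real_vector) \<Rightarrow> ('y::real_normed_vector \<Rightarrow> 'v) \<Rightarrow> 'v set" where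
  "sum_space i j = {i a + j b | a b. True}"

definition sum_norm ::
    "('x::real_normed_vector \<Rightarrow> 'v::real_vector) \<Rightarrow> ('y::real_normed_vector \<Rightarrow> 'v) \<Rightarrow>
     'v \<Rightarrow> real" where
  "sum_norm i j z = Inf {norm a + norm b | a b. i a + j b = z}"

subsection \<open>Trace method\<close>

text \<open>
  \<open>u\<close> belongs to \<open>W\<^sup>1\<^sup>,\<^sup>\<Phi>(X,Y)\<close>; \<open>y\<close> is \<open>u\<close> regarded as an element of \<open>\<Phi>(Y)\<close>, and \<open>w\<close> is the derivative
  of \<open>u\<close> regarded as an element of \<open>\<Phi>(X)\<close>.  Both are determined by \<open>u\<close> almost everywhere.
\<close>

definition W1_data ::
    "(real \<Rightarrow> complex) set \<Rightarrow>
     ('x::real_normed_vector \<Rightarrow> 'v::real_vector) \<Rightarrow> ('y::real_normed_vector \<Rightarrow> 'v) \<Rightarrow>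
     (real \<Rightarrow> 'v) \<Rightarrow> (real \<Rightarrow> 'y) \<Rightarrow> (real \<Rightarrow> 'x) \<Rightarrow> bool" where
  "W1_data \<Phi> i j u y w \<longleftrightarrow>
     y \<in> bochner_space \<Phi> \<and> (AE t in halfline. u t = j (y t)) \<and>
     w \<in> bochner_space \<Phi> \<and> W11_loc_in (sum_space i j) (sum_norm i j) u (\<lambda>t. i (w t))"

definition trace_space ::
    "(real \<Rightarrow> complex) set \<Rightarrow>
     ('x::real_normed_vector \<Rightarrow> 'v::real_vector) \<Rightarrow> ('y::real_normed_vector \<Rightarrow> 'v) \<Rightarrow> 'v set" where
  "trace_space \<Phi> i j = {u 0 | u y w. W1_data \<Phi> i j u y w}"

definition trace_norm ::
    "(real \<Rightarrow> complex) set \<Rightarrow> ((real \<Rightarrow> complex) \<Rightarrow> real) \<Rightarrow>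
     ('x::real_normed_vector \<Rightarrow> 'v::real_vector) \<Rightarrow> ('y::real_normed_vector \<Rightarrow> 'v) \<Rightarrow>
     'v \<Rightarrow> real" where
  "trace_norm \<Phi> N i j x =
     Inf {bochner_norm N y + bochner_norm N w | u y w. W1_data \<Phi> i j u y w \<and> u 0 = x}"

subsection \<open>K-method\<close>

definition K_functional ::
    "('x::real_normed_vector \<Rightarrow> 'v::real_vector) \<Rightarrow> ('y::real_normed_vector \<Rightarrow> 'v) \<Rightarrow>
     real \<Rightarrow> 'v \<Rightarrow> real" where
  "K_functional i j t x = Inf {norm a + t * norm b | a b. i a + j b = x}"

definition K_space ::
    "(real \<Rightarrow> complex) set \<Rightarrow>
     ('x::real_normed_vector \<Rightarrow> 'v::real_vector) \<Rightarrow> ('y::real_normed_vector \<Rightarrow> 'v) \<Rightarrow> 'v set" where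
  "K_space \<Phi> i j =
     {x \<in> sum_space i j. (\<lambda>t. complex_of_real (K_functional i j t x / t)) \<in> \<Phi>}"

definition K_norm ::
    "((real \<Rightarrow> complex) \<Rightarrow> real) \<Rightarrow>
     ('x::real_normed_vector \<Rightarrow> 'v::real_vector) \<Rightarrow> ('y::real_normed_vector \<Rightarrow> 'v) \<Rightarrow>
     'v \<Rightarrow> real" where
  "K_norm N i j x = N (\<lambda>t. complex_of_real (K_functional i j t x / t))"

text \<open>Equality of normed spaces in interpolation theory: same elements and equivalent norms.\<close>

definition equal_with_equivalent_norms ::
    "'v set \<Rightarrow> ('v \<Rightarrow> real) \<Rightarrow> 'v set \<Rightarrow> ('v \<Rightarrow> real) \<Rightarrow> bool" where
  "equal_with_equivalent_norms A p B q \<longleftrightarrow>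
     A = B \<and> (\<exists>c>0. \<exists>C>0. \<forall>x\<in>A. c * q x \<le> p x \<and> p x \<le> C * q x)"

end

(*
  For t > 0 the K-functional K(t,.) is a seminorm on X + Y that is equivalent to the sum norm, so it
  may be pulled inside Bochner integrals in X + Y.  If u' = w, then K(t, u(0) - u(t)) is at most the
  integral of |w|_X over [0,t], and K(t, u(t)) <= t |u(t)|_Y; hence K(t,x)/t is dominated by
  P|w|_X + |u|_Y for x = u(0), which gives one inclusion by boundedness of P.  Conversely, choose
  almost optimal decompositions x = a_n + b_n at t = 2^n and let u interpolate smoothly between the
  values b_n at 2^n.  As b_(n+1) - b_n = a_n - a_(n+1) lies in X, both |u|_Y and |u'|_X are bounded
  by multiples of K(t,x)/t, and u(0) = x because local integrability of the decreasing function
  K(t,x)/t forces K(t,x) -> 0 as t -> 0.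
*)

theory Submission
  imports Defs
begin

section \<open>Bochner integrals and seminorms\<close>

text \<open>For a trace, \<open>u 0 - u t\<close> is never written as an integral of the derivative:
  a \<open>C^1\<close> cutoff of \<open>[0,t]\<close> is inserted into the weak formulation, and
  only an inequality between seminorms survives when its transition zones shrink. The cutoff has to
  start at a positive point, since test functions vanish near 0; continuity of \<open>u\<close> at 0
  bridges the gap. In the converse direction the interpolation is locally finite on the open half
  line: on a compact subinterval \<open>u\<close> is a fixed vector plus finitely many scalar
  \<open>C^1\<close> functions times fixed vectors, so that weak derivative and continuity become
  calculus of real functions. At 0 the dyadic points accumulate and this fails; there
  \<open>x - u t\<close> is a convex combination of two vectors \<open>a_n\<close>, which
  \<open>K(t,x)\<close> controls. Powers of 2 are a good scale because \<open>K\<close> at most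
  doubles when \<open>t\<close> doubles. The infimum in \<open>K\<close> need not be attained, so
  decompositions are optimal up to a factor 2, which can be achieved for nonzero \<open>x\<close>
  only because \<open>K(t,x) > 0\<close>; this rests on definiteness of the sum norm.\<close>

lemma ennreal_le_plusI: "0 \<le> b \<Longrightarrow> 0 \<le> c \<Longrightarrow> a \<le> b + c \<Longrightarrow> ennreal a \<le> ennreal b + ennreal c"
  by (metis ennreal_leI ennreal_plus)

lemma strongly_measurable_inE:
  assumes "strongly_measurable_in S n M f"
  obtains s where "\<And>k. simple_function M (s k)" "\<And>k. s k ` space M \<subseteq> S"
    "AE t in M. (\<lambda>k. n (f t - s k t)) \<longlonglongrightarrow> 0"
  using assms unfolding strongly_measurable_in_def by blast

lemma has_bochner_integral_inE:
  assumes "has_bochner_integral_in S n M f z"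
  obtains s where "strongly_measurable_in S n M f" "z \<in> S"
    "\<And>k. Bochner_Integration.simple_bochner_integrable M (s k)" "\<And>k. s k ` space M \<subseteq> S"
    "(\<lambda>k. \<integral>\<^sup>+t. ennreal (n (f t - s k t)) \<partial>M) \<longlonglongrightarrow> 0"
    "(\<lambda>k. n (Bochner_Integration.simple_bochner_integral M (s k) - z)) \<longlonglongrightarrow> 0"
  using assms unfolding has_bochner_integral_in_def by blast

text \<open>Stated for a seminorm on a subspace, so that the same facts serve the sum norm, every
  \<open>K t\<close> on the sum space, and the norms of \<open>'x\<close> and \<open>'y\<close> on
  \<open>UNIV\<close>. Nothing is known about \<open>p\<close> outside \<open>S\<close>.\<close>

locale seminormed =
  fixes S :: "'v::real_vector set" and p :: "'v \<Rightarrow> real"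
  assumes subspace: "subspace S"
    and triangle: "x \<in> S \<Longrightarrow> y \<in> S \<Longrightarrow> p (x + y) \<le> p x + p y"
    and scale: "x \<in> S \<Longrightarrow> p (c *\<^sub>R x) = \<bar>c\<bar> * p x"
begin

lemmas mem_simps [simp, intro] = subspace_0[OF subspace] subspace_add[OF subspace]
  subspace_diff[OF subspace] subspace_scale[OF subspace] subspace_neg[OF subspace]

lemma zero [simp]: "p 0 = 0"
  using scale[of 0 0] by simp

lemma uminus [simp]: "x \<in> S \<Longrightarrow> p (- x) = p x"
  using scale[of x "-1"] by simp

lemma triangle_diff: "x \<in> S \<Longrightarrow> y \<in> S \<Longrightarrow> p (x - y) \<le> p x + p y"
  using triangle[of x "- y"] by simp

lemma minus_commute: "x \<in> S \<Longrightarrow> y \<in> S \<Longrightarrow> p (x - y) = p (y - x)"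
  using uminus[of "x - y"] by simp

lemma nonneg [simp]: "x \<in> S \<Longrightarrow> 0 \<le> p x"
  using triangle[of x "- x"] by simp

lemma triangle_add: "x \<in> S \<Longrightarrow> y \<in> S \<Longrightarrow> p x \<le> p y + p (x - y)"
  using triangle[of y "x - y"] by simp

lemma abs_diff_le: "x \<in> S \<Longrightarrow> y \<in> S \<Longrightarrow> \<bar>p x - p y\<bar> \<le> p (x - y)"
  using triangle_add[of x y] triangle_add[of y x] minus_commute[of x y] by linarith

lemma sum_le: "(\<And>a. a \<in> A \<Longrightarrow> f a \<in> S) \<Longrightarrow> p (sum f A) \<le> (\<Sum>a\<in>A. p (f a))"
proof (induction A rule: infinite_finite_induct)
  case (insert a A)
  then show ?case
    using triangle[of "f a" "sum f A"] subspace_sum[OF subspace, of A f] by simp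
qed auto

lemma simple_bochner_integral_mem:
  "s ` space M \<subseteq> S \<Longrightarrow> Bochner_Integration.simple_bochner_integral M s \<in> S"
  unfolding Bochner_Integration.simple_bochner_integral_def by (intro subspace_sum[OF subspace]) auto

text \<open>The triangle inequality for the finite sum over the values of \<open>s\<close>,
  regrouped as the integral of the simple function \<open>p (s t)\<close>.\<close>

lemma simple_bochner_integral_le:
  assumes s: "Bochner_Integration.simple_bochner_integrable M s" and S: "s ` space M \<subseteq> S"
  shows "ennreal (p (Bochner_Integration.simple_bochner_integral M s)) \<le> (\<integral>\<^sup>+t. ennreal (p (s t)) \<partial>M)"
proof -
  have sf: "simple_function M s"
    using s by (auto elim: simple_bochner_integrable.cases)
  \<comment> \<open>The absolute value changes nothing on \<open>S\<close>, but makes the integrand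
    nonnegative everywhere, also where \<open>p\<close> might be negative outside
    \<open>S\<close>.\<close>
  have s': "Bochner_Integration.simple_bochner_integrable M (\<lambda>t. \<bar>p (s t)\<bar>)"
    using simple_bochner_integrable_compose2[of "\<lambda>x y. \<bar>p x\<bar>", OF _ s s] by simp
  have "p (Bochner_Integration.simple_bochner_integral M s) \<le>
      (\<Sum>y\<in>s ` space M. p (measure M {x \<in> space M. s x = y} *\<^sub>R y))"
    unfolding Bochner_Integration.simple_bochner_integral_def using S by (intro sum_le) auto
  also have "\<dots> = (\<Sum>y\<in>s ` space M. measure M {x \<in> space M. s x = y} *\<^sub>R \<bar>p y\<bar>)"
    using S by (intro sum.cong refl) (auto simp: scale image_subset_iff)
  also have "\<dots> = Bochner_Integration.simple_bochner_integral M (\<lambda>t. \<bar>p (s t)\<bar>)"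
    using s' sf by (intro simple_bochner_integral_partition[symmetric]) auto
  finally have "ennreal (p (Bochner_Integration.simple_bochner_integral M s)) \<le>
      (\<integral>\<^sup>+t. ennreal \<bar>p (s t)\<bar> \<partial>M)"
    by (subst simple_bochner_integral_eq_nn_integral[OF s', symmetric]) (auto intro: ennreal_leI)
  also have "\<dots> = (\<integral>\<^sup>+t. ennreal (p (s t)) \<partial>M)"
    using S by (intro nn_integral_cong) (auto simp: image_subset_iff)
  finally show ?thesis .
qed

end

section \<open>Measurability of almost everywhere limits\<close>

lemma complete_measure_lebesgue_on:
  assumes "S \<in> sets lebesgue"
  shows "complete_measure (lebesgue_on S)"
proof
  fix A B assume "B \<subseteq> A" "A \<in> null_sets (lebesgue_on S)"
  then show "B \<in> sets (lebesgue_on S)"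
    using assms null_sets_completion_subset[of B A lborel]
    by (auto simp: null_sets_restrict_space sets_restrict_space_iff)
qed

lemma (in complete_measure) borel_measurable_AE_eq:
  fixes f :: "'a \<Rightarrow> 'b::topological_space"
  assumes f: "f \<in> borel_measurable M" and eq: "AE x in M. f x = g x"
  shows "g \<in> borel_measurable M"
proof (rule measurableI)
  fix A :: "'b set" assume "A \<in> sets borel"
  then show "g -` A \<inter> space M \<in> sets M"
    by (intro in_sets_AE[OF _ measurable_sets[OF f]])
       (use eq AE_space in \<open>auto elim!: eventually_elim2\<close>)
qed auto

lemma simple_bochner_integrable_add:
  "Bochner_Integration.simple_bochner_integrable M s \<Longrightarrow>
   Bochner_Integration.simple_bochner_integrable M s' \<Longrightarrow>
   Bochner_Integration.simple_bochner_integrable M (\<lambda>t. s t + s' t)"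
  by (rule simple_bochner_integrable_compose2) auto

text \<open>Strong measurability provides convergence only almost everywhere; completeness of the
  measure absorbs the exceptional null set.\<close>

lemma (in complete_measure) borel_measurable_AE_lim:
  fixes f :: "nat \<Rightarrow> 'a \<Rightarrow> 'b::metric_space"
  assumes f: "\<And>k. f k \<in> borel_measurable M" and lim: "AE x in M. (\<lambda>k. f k x) \<longlonglongrightarrow> g x"
  shows "g \<in> borel_measurable M"
proof -
  let ?A = "{x\<in>space M. \<not> (\<lambda>k. f k x) \<longlonglongrightarrow> g x}"
  have A: "?A \<in> null_sets M"
    using lim unfolding AE_iff_null_sets .
  then have [measurable]: "?A \<in> sets M" by auto
  \<comment> \<open>An arbitrary value \<open>c\<close>, put on the exceptional set, makes the
    modified sequence converge everywhere.\<close>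
  obtain c :: 'b where True by blast
  let ?f = "\<lambda>k x. if x \<in> ?A then c else f k x" and ?g = "\<lambda>x. if x \<in> ?A then c else g x"
  have "?g \<in> borel_measurable M"
  proof (rule borel_measurable_LIMSEQ_metric)
    show "?f k \<in> borel_measurable M" for k
      using f[of k] by (intro measurable_If_set) auto
    show "(\<lambda>k. ?f k x) \<longlonglongrightarrow> ?g x" if "x \<in> space M" for x
      using that by (cases "x \<in> ?A") auto
  qed
  moreover have "AE x in M. ?g x = g x"
    using lim by eventually_elim auto
  ultimately show ?thesis by (rule borel_measurable_AE_eq)
qed

section \<open>Strong measurability and Bochner integrals in a seminormed subspace\<close>

context seminormed
begin

lemma strongly_measurable_in_mem: "strongly_measurable_in S p M f \<Longrightarrow> t \<in> space M \<Longrightarrow> f t \<in> S"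
  by (auto simp: strongly_measurable_in_def)

text \<open>Applied to the errors \<open>f t - s k t\<close> in the definition of the integral:
  their seminorm must be measurable before integrals of sums can be split.\<close>

lemma strongly_measurable_in_diff_simple:
  assumes f: "strongly_measurable_in S p M f" and s: "simple_function M s" "s ` space M \<subseteq> S"
  shows "strongly_measurable_in S p M (\<lambda>t. f t - s t)"
proof -
  obtain s' where s': "\<And>k. simple_function M (s' k)" "\<And>k. s' k ` space M \<subseteq> S"
      "AE t in M. (\<lambda>k. p (f t - s' k t)) \<longlonglongrightarrow> 0"
    using f by (rule strongly_measurable_inE) (rule that)
  show ?thesis
    unfolding strongly_measurable_in_def
  proof (intro conjI exI[of _ "\<lambda>k t. s' k t - s t"] allI)
    show "(\<lambda>t. f t - s t) ` space M \<subseteq> S"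
      using f s(2) by (auto simp: strongly_measurable_in_def image_subset_iff)
    show "simple_function M (\<lambda>t. s' k t - s t)" "(\<lambda>t. s' k t - s t) ` space M \<subseteq> S" for k
      using s' s(2) by (auto simp: image_subset_iff intro: simple_function_compose2 s)
    show "AE t in M. (\<lambda>k. p (f t - s t - (s' k t - s t))) \<longlonglongrightarrow> 0"
      using s'(3) by simp
  qed
qed

lemma strongly_measurable_in_add:
  assumes f: "strongly_measurable_in S p M f" and g: "strongly_measurable_in S p M g"
  shows "strongly_measurable_in S p M (\<lambda>t. f t + g t)"
proof -
  obtain s where s: "\<And>k. simple_function M (s k)" "\<And>k. s k ` space M \<subseteq> S"
      "AE t in M. (\<lambda>k. p (f t - s k t)) \<longlonglongrightarrow> 0"
    using f by (rule strongly_measurable_inE) (rule that)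
  obtain s' where s': "\<And>k. simple_function M (s' k)" "\<And>k. s' k ` space M \<subseteq> S"
      "AE t in M. (\<lambda>k. p (g t - s' k t)) \<longlonglongrightarrow> 0"
    using g by (rule strongly_measurable_inE) (rule that)
  show ?thesis
    unfolding strongly_measurable_in_def
  proof (intro conjI exI[of _ "\<lambda>k t. s k t + s' k t"] allI)
    show "(\<lambda>t. f t + g t) ` space M \<subseteq> S"
      using f g by (auto simp: strongly_measurable_in_def image_subset_iff)
    show "simple_function M (\<lambda>t. s k t + s' k t)" "(\<lambda>t. s k t + s' k t) ` space M \<subseteq> S" for k
      using s s' by (auto simp: image_subset_iff intro: simple_function_compose2)
    show "AE t in M. (\<lambda>k. p (f t + g t - (s k t + s' k t))) \<longlonglongrightarrow> 0"
      using s(3) s'(3) AE_space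
    proof eventually_elim
      case (elim t)
      have mem: "f t - s k t \<in> S" "g t - s' k t \<in> S" for k
        using elim(3) s(2)[of k] s'(2)[of k] f g by (auto simp: strongly_measurable_in_def image_subset_iff)
      have "p (f t + g t - (s k t + s' k t)) \<le> p (f t - s k t) + p (g t - s' k t)"
        "0 \<le> p (f t + g t - (s k t + s' k t))" for k
        using triangle[OF mem[of k]] nonneg[OF mem_simps(2)[OF mem[of k]]] by (simp_all add: add_diff_add)
      then show ?case
        by (intro tendsto_sandwich[OF _ _ tendsto_const tendsto_add_zero[OF elim(1,2)]]) auto
    qed
  qed
qed

lemma strongly_measurable_in_cong_AE:
  assumes f: "strongly_measurable_in S p M f" and g: "g ` space M \<subseteq> S" and eq: "AE t in M. f t = g t"
  shows "strongly_measurable_in S p M g"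
proof -
  obtain s where s: "\<And>k. simple_function M (s k)" "\<And>k. s k ` space M \<subseteq> S"
      "AE t in M. (\<lambda>k. p (f t - s k t)) \<longlonglongrightarrow> 0"
    using f by (rule strongly_measurable_inE) (rule that)
  moreover have "AE t in M. (\<lambda>k. p (g t - s k t)) \<longlonglongrightarrow> 0"
    using s(3) eq by eventually_elim simp
  ultimately show ?thesis
    using g unfolding strongly_measurable_in_def by blast
qed

text \<open>Covers functions whose vector factor depends only on the dyadic interval containing
  \<open>t\<close>; a constant \<open>m\<close> yields a scalar function times one vector.\<close>

lemma strongly_measurable_in_piecewise:
  fixes m :: "'a \<Rightarrow> 'i::countable" and g :: "'a \<Rightarrow> real"
  assumes m: "m \<in> measurable M (count_space UNIV)" and g: "g \<in> borel_measurable M"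
    and z: "\<And>n. z n \<in> S"
  shows "strongly_measurable_in S p M (\<lambda>t. g t *\<^sub>R z (m t))"
proof -
  obtain F where F: "\<And>k. simple_function M (F k)" "\<And>t. t \<in> space M \<Longrightarrow> (\<lambda>k. F k t) \<longlonglongrightarrow> g t"
    using borel_measurable_implies_sequence_metric[OF g, of 0] by blast
  \<comment> \<open>Cutting the enumerated index at \<open>k\<close> leaves finitely many vectors.
    Once \<open>k\<close> reaches \<open>to_nat (m t)\<close> the vector is the exact one, and only
    the error of the scalar factor is left.\<close>
  let ?l = "\<lambda>k t. min (to_nat (m t)) k"
  let ?s = "\<lambda>k t. F k t *\<^sub>R z (from_nat (?l k t))"
  have l: "simple_function M (?l k)" for k
  proof -
    have "?l k ` space M \<subseteq> {..k}" by auto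
    then have "finite (?l k ` space M)" by (rule finite_subset) simp
    moreover have "?l k \<in> measurable M (count_space UNIV)"
      by (rule measurable_compose[OF m]) simp
    then have "?l k -` {n} \<inter> space M \<in> sets M" for n
      by (rule measurable_sets) simp
    ultimately show ?thesis
      by (simp add: simple_function_def)
  qed
  show ?thesis
    unfolding strongly_measurable_in_def
  proof (intro conjI exI[of _ ?s] allI)
    show "simple_function M (?s k)" for k
      using simple_function_compose2[OF F(1) l, of "\<lambda>r n. r *\<^sub>R z (from_nat n)"] .
    show "AE t in M. (\<lambda>k. p (g t *\<^sub>R z (m t) - ?s k t)) \<longlonglongrightarrow> 0"
    proof (rule AE_I2)
      fix t assume t: "t \<in> space M"
      have "(\<lambda>k. \<bar>g t - F k t\<bar> * p (z (m t))) \<longlonglongrightarrow> \<bar>g t - g t\<bar> * p (z (m t))"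
        by (intro tendsto_intros F t)
      moreover have "\<forall>\<^sub>F k in sequentially. \<bar>g t - F k t\<bar> * p (z (m t)) = p (g t *\<^sub>R z (m t) - ?s k t)"
        using eventually_ge_at_top[of "to_nat (m t)"]
        by eventually_elim (simp only: min_absorb1 from_nat_to_nat scale z flip: scaleR_diff_left)
      ultimately show "(\<lambda>k. p (g t *\<^sub>R z (m t) - ?s k t)) \<longlonglongrightarrow> 0"
        using Lim_transform_eventually by fastforce
    qed
  qed (use z mem_simps(4) in blast)+
qed

text \<open>\<open>p\<close> is Lipschitz with respect to \<open>n\<close>, so \<open>p\<close> of
  the approximants converges to \<open>p\<close> of the function.\<close>

lemma strongly_measurable_in_borel_seminorm:
  assumes f: "strongly_measurable_in S n M f" and M: "complete_measure M"
    and le: "\<And>x. x \<in> S \<Longrightarrow> p x \<le> C * n x"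
  shows "(\<lambda>t. p (f t)) \<in> borel_measurable M"
proof -
  obtain s where s: "\<And>k. simple_function M (s k)" "\<And>k. s k ` space M \<subseteq> S"
      "AE t in M. (\<lambda>k. n (f t - s k t)) \<longlonglongrightarrow> 0"
    using f by (rule strongly_measurable_inE) (rule that)
  show ?thesis
  proof (rule complete_measure.borel_measurable_AE_lim[OF M])
    show "(\<lambda>t. p (s k t)) \<in> borel_measurable M" for k
      using simple_function_compose1[OF s(1)[of k], of p] by (rule borel_measurable_simple_function)
    show "AE t in M. (\<lambda>k. p (s k t)) \<longlonglongrightarrow> p (f t)"
      using s(3) AE_space
    proof eventually_elim
      case (elim t)
      have mem: "f t \<in> S" "s k t \<in> S" for k
        using elim f s(2)[of k] by (auto simp: strongly_measurable_in_def image_subset_iff)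
      have "\<bar>p (s k t) - p (f t)\<bar> \<le> C * n (f t - s k t)" for k
        using abs_diff_le[OF mem(2)[of k] mem(1)] le[of "f t - s k t"] mem(1) mem(2)[of k]
          minus_commute[OF mem(2)[of k] mem(1)] by force
      moreover have "(\<lambda>k. C * n (f t - s k t)) \<longlonglongrightarrow> 0"
        using tendsto_mult_left[OF elim(1), of C] by simp
      ultimately have "(\<lambda>k. p (s k t) - p (f t)) \<longlonglongrightarrow> 0"
        using Lim_null_comparison[of "\<lambda>k. p (s k t) - p (f t)" "\<lambda>k. C * n (f t - s k t)" sequentially]
        by simp
      then show ?case by (rule LIM_zero_cancel)
    qed
  qed
qed

text \<open>A seminorm dominated by the norm of the integral passes under the integral sign.\<close>

lemma has_bochner_integral_in_seminorm_le:
  assumes f: "has_bochner_integral_in S n M f z" and M: "complete_measure M"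
    and n: "seminormed S n" and le: "\<And>x. x \<in> S \<Longrightarrow> p x \<le> C * n x" and C: "0 \<le> C"
  shows "ennreal (p z) \<le> (\<integral>\<^sup>+t. ennreal (p (f t)) \<partial>M)"
proof -
  interpret n: seminormed S n by fact
  obtain s where s: "\<And>k. Bochner_Integration.simple_bochner_integrable M (s k)"
      "\<And>k. s k ` space M \<subseteq> S"
      "(\<lambda>k. \<integral>\<^sup>+t. ennreal (n (f t - s k t)) \<partial>M) \<longlonglongrightarrow> 0"
      "(\<lambda>k. n (Bochner_Integration.simple_bochner_integral M (s k) - z)) \<longlonglongrightarrow> 0"
    and fm: "strongly_measurable_in S n M f" and z: "z \<in> S"
    using f by (rule has_bochner_integral_inE) (rule that)
  have sf: "simple_function M (s k)" for k
    using s(1)[of k] by (auto elim: simple_bochner_integrable.cases)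
  have fS: "f t \<in> S" if "t \<in> space M" for t
    using n.strongly_measurable_in_mem[OF fm that] .
  let ?I = "\<lambda>k. Bochner_Integration.simple_bochner_integral M (s k)"
  have I: "?I k \<in> S" for k
    using s(2) by (rule simple_bochner_integral_mem)
  let ?J = "\<integral>\<^sup>+t. ennreal (p (f t)) \<partial>M"
  \<comment> \<open>Replacing \<open>z\<close> by the integral of \<open>s k\<close>, and then
    \<open>s k\<close> by \<open>f\<close> under the integral, costs \<open>C\<close> times two
    errors that tend to 0 by definition of the integral.\<close>
  have bound: "ennreal (p z) \<le> ?J + (ennreal C * (\<integral>\<^sup>+t. ennreal (n (f t - s k t)) \<partial>M)
      + ennreal (C * n (?I k - z)))" for k
  proof -
    have m1: "(\<lambda>t. p (f t)) \<in> borel_measurable M"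
      by (rule strongly_measurable_in_borel_seminorm[OF fm M le])
    have m2: "(\<lambda>t. n (f t - s k t)) \<in> borel_measurable M"
      by (rule n.strongly_measurable_in_borel_seminorm
          [OF n.strongly_measurable_in_diff_simple[OF fm sf s(2)] M, of 1]) simp
    have "p z \<le> p (?I k) + C * n (?I k - z)"
      using triangle_add[OF z I, of k] minus_commute[OF z I, of k] le[of "?I k - z"] I[of k] z by force
    then have "ennreal (p z) \<le> ennreal (p (?I k)) + ennreal (C * n (?I k - z))"
      using I[of k] z C by (intro ennreal_le_plusI) auto
    also have "ennreal (p (?I k)) \<le> (\<integral>\<^sup>+t. ennreal (p (s k t)) \<partial>M)"
      by (rule simple_bochner_integral_le[OF s(1,2)])
    also have "\<dots> \<le> (\<integral>\<^sup>+t. ennreal (p (f t)) + ennreal C * ennreal (n (f t - s k t)) \<partial>M)"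
    proof (rule nn_integral_mono)
      fix t assume t: "t \<in> space M"
      have mem: "f t \<in> S" "s k t \<in> S" using fS t s(2)[of k] by auto
      have "p (s k t) \<le> p (f t) + C * n (f t - s k t)"
        using triangle_add[OF mem(2,1)] minus_commute[OF mem] le[of "f t - s k t"] mem by force
      then show "ennreal (p (s k t)) \<le> ennreal (p (f t)) + ennreal C * ennreal (n (f t - s k t))"
        using mem C ennreal_le_plusI[of "p (f t)" "C * n (f t - s k t)" "p (s k t)"]
        by (simp add: ennreal_mult)
    qed
    also have "\<dots> = ?J + ennreal C * (\<integral>\<^sup>+t. ennreal (n (f t - s k t)) \<partial>M)"
      using m1 m2 by (simp add: nn_integral_add nn_integral_cmult)
    finally show ?thesis by (simp add: add.assoc add_right_mono)
  qed
  have "(\<lambda>k. ?J + (ennreal C * (\<integral>\<^sup>+t. ennreal (n (f t - s k t)) \<partial>M) + ennreal (C * n (?I k - z))))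
      \<longlonglongrightarrow> ?J + (ennreal C * 0 + ennreal (C * 0))"
    using s(3,4) by (intro tendsto_intros) auto
  then show ?thesis
    using bound by (intro Lim_bounded2[where N=0]) auto
qed

lemma has_bochner_integral_in_add:
  assumes f: "has_bochner_integral_in S p M f z" and g: "has_bochner_integral_in S p M g z'"
    and M: "complete_measure M"
  shows "has_bochner_integral_in S p M (\<lambda>t. f t + g t) (z + z')"
proof -
  obtain s where s: "\<And>k. Bochner_Integration.simple_bochner_integrable M (s k)"
      "\<And>k. s k ` space M \<subseteq> S"
      "(\<lambda>k. \<integral>\<^sup>+t. ennreal (p (f t - s k t)) \<partial>M) \<longlonglongrightarrow> 0"
      "(\<lambda>k. p (Bochner_Integration.simple_bochner_integral M (s k) - z)) \<longlonglongrightarrow> 0"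
    and fm: "strongly_measurable_in S p M f" and z: "z \<in> S"
    using f by (rule has_bochner_integral_inE) (rule that)
  obtain s' where s': "\<And>k. Bochner_Integration.simple_bochner_integrable M (s' k)"
      "\<And>k. s' k ` space M \<subseteq> S"
      "(\<lambda>k. \<integral>\<^sup>+t. ennreal (p (g t - s' k t)) \<partial>M) \<longlonglongrightarrow> 0"
      "(\<lambda>k. p (Bochner_Integration.simple_bochner_integral M (s' k) - z')) \<longlonglongrightarrow> 0"
    and gm: "strongly_measurable_in S p M g" and z': "z' \<in> S"
    using g by (rule has_bochner_integral_inE) (rule that)
  let ?I = "\<lambda>k. Bochner_Integration.simple_bochner_integral M (s k)"
  let ?I' = "\<lambda>k. Bochner_Integration.simple_bochner_integral M (s' k)"
  have sf: "simple_function M (s k)" "simple_function M (s' k)" for k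
    using s(1)[of k] s'(1)[of k] by (auto elim: simple_bochner_integrable.cases)
  show ?thesis
    unfolding has_bochner_integral_in_def
  proof (intro conjI exI[of _ "\<lambda>k t. s k t + s' k t"] allI)
    show "strongly_measurable_in S p M (\<lambda>t. f t + g t)"
      by (rule strongly_measurable_in_add[OF fm gm])
    show "z + z' \<in> S" using z z' by auto
    show "Bochner_Integration.simple_bochner_integrable M (\<lambda>t. s k t + s' k t)" for k
      using s(1) s'(1) by (rule simple_bochner_integrable_add)
    show "(\<lambda>t. s k t + s' k t) ` space M \<subseteq> S" for k
      using s(2)[of k] s'(2)[of k] by auto
    show "(\<lambda>k. \<integral>\<^sup>+t. ennreal (p (f t + g t - (s k t + s' k t))) \<partial>M) \<longlonglongrightarrow> 0"
    proof (rule tendsto_sandwich[OF _ _ tendsto_const])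
      show "(\<lambda>k. (\<integral>\<^sup>+t. ennreal (p (f t - s k t)) \<partial>M) + (\<integral>\<^sup>+t. ennreal (p (g t - s' k t)) \<partial>M)) \<longlonglongrightarrow> 0"
        using tendsto_add[OF s(3) s'(3)] by simp
      show "\<forall>\<^sub>F k in sequentially. (\<integral>\<^sup>+t. ennreal (p (f t + g t - (s k t + s' k t))) \<partial>M)
          \<le> (\<integral>\<^sup>+t. ennreal (p (f t - s k t)) \<partial>M) + (\<integral>\<^sup>+t. ennreal (p (g t - s' k t)) \<partial>M)"
      proof (rule always_eventually, rule allI)
        fix k
        have m: "(\<lambda>t. p (f t - s k t)) \<in> borel_measurable M" "(\<lambda>t. p (g t - s' k t)) \<in> borel_measurable M"
          by (rule strongly_measurable_in_borel_seminorm
              [OF strongly_measurable_in_diff_simple[OF fm sf(1) s(2)] M, of 1], simp)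
             (rule strongly_measurable_in_borel_seminorm
              [OF strongly_measurable_in_diff_simple[OF gm sf(2) s'(2)] M, of 1], simp)
        have "(\<integral>\<^sup>+t. ennreal (p (f t + g t - (s k t + s' k t))) \<partial>M) \<le>
            (\<integral>\<^sup>+t. ennreal (p (f t - s k t)) + ennreal (p (g t - s' k t)) \<partial>M)"
        proof (rule nn_integral_mono)
          fix t assume t: "t \<in> space M"
          have mem: "f t - s k t \<in> S" "g t - s' k t \<in> S"
            using strongly_measurable_in_mem[OF fm t] strongly_measurable_in_mem[OF gm t]
              s(2)[of k] s'(2)[of k] t by (auto simp: image_subset_iff)
          show "ennreal (p (f t + g t - (s k t + s' k t))) \<le> ennreal (p (f t - s k t)) + ennreal (p (g t - s' k t))"
            using triangle[OF mem] mem
            by (intro ennreal_le_plusI) (auto simp: add_diff_add)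
        qed
        also have "\<dots> = (\<integral>\<^sup>+t. ennreal (p (f t - s k t)) \<partial>M) + (\<integral>\<^sup>+t. ennreal (p (g t - s' k t)) \<partial>M)"
          using m by (intro nn_integral_add) auto
        finally show "(\<integral>\<^sup>+t. ennreal (p (f t + g t - (s k t + s' k t))) \<partial>M)
          \<le> (\<integral>\<^sup>+t. ennreal (p (f t - s k t)) \<partial>M) + (\<integral>\<^sup>+t. ennreal (p (g t - s' k t)) \<partial>M)" .
      qed
    qed simp
    show "(\<lambda>k. p (Bochner_Integration.simple_bochner_integral M (\<lambda>t. s k t + s' k t) - (z + z'))) \<longlonglongrightarrow> 0"
    proof (rule tendsto_sandwich[OF _ _ tendsto_const])
      show "(\<lambda>k. p (?I k - z) + p (?I' k - z')) \<longlonglongrightarrow> 0"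
        using tendsto_add[OF s(4) s'(4)] by simp
      have mem: "?I k - z \<in> S" "?I' k - z' \<in> S" for k
        using simple_bochner_integral_mem[OF s(2)] simple_bochner_integral_mem[OF s'(2)] z z' by auto
      have eq: "Bochner_Integration.simple_bochner_integral M (\<lambda>t. s k t + s' k t) - (z + z')
          = (?I k - z) + (?I' k - z')" for k
        using s(1) s'(1) by (simp add: simple_bochner_integral_add)
      show "\<forall>\<^sub>F k in sequentially. p (Bochner_Integration.simple_bochner_integral M (\<lambda>t. s k t + s' k t) - (z + z'))
          \<le> p (?I k - z) + p (?I' k - z')"
        unfolding eq using triangle[OF mem] by auto
      show "\<forall>\<^sub>F k in sequentially.
          0 \<le> p (Bochner_Integration.simple_bochner_integral M (\<lambda>t. s k t + s' k t) - (z + z'))"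
        unfolding eq using mem by (intro always_eventually allI nonneg) auto
    qed
  qed
qed

text \<open>Simple functions approximating \<open>g\<close>, multiplied by \<open>z\<close>,
  approximate the product; every error is multiplied by \<open>p z\<close>.\<close>

lemma has_bochner_integral_in_scaleR:
  fixes g :: "'a \<Rightarrow> real"
  assumes g: "integrable M g" and z: "z \<in> S"
  shows "has_bochner_integral_in S p M (\<lambda>t. g t *\<^sub>R z) ((\<integral>t. g t \<partial>M) *\<^sub>R z)"
proof -
  have "has_bochner_integral M g (\<integral>t. g t \<partial>M)"
    using g by (rule has_bochner_integral_integrable)
  then obtain s where gm: "g \<in> borel_measurable M"
    and s: "\<And>k. Bochner_Integration.simple_bochner_integrable M (s k)"
      "(\<lambda>k. \<integral>\<^sup>+t. ennreal (norm (g t - s k t)) \<partial>M) \<longlonglongrightarrow> 0"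
      "(\<lambda>k. Bochner_Integration.simple_bochner_integral M (s k)) \<longlonglongrightarrow> (\<integral>t. g t \<partial>M)"
    unfolding has_bochner_integral.simps by blast
  have sm: "s k \<in> borel_measurable M" for k
    using s(1)[of k] by (auto elim!: simple_bochner_integrable.cases intro: borel_measurable_simple_function)
  show ?thesis
    unfolding has_bochner_integral_in_def
  proof (intro conjI exI[of _ "\<lambda>k t. s k t *\<^sub>R z"] allI)
    show "strongly_measurable_in S p M (\<lambda>t. g t *\<^sub>R z)"
      using strongly_measurable_in_piecewise[OF _ gm, of "\<lambda>_. ()" "\<lambda>_. z"] z by simp
    show "Bochner_Integration.simple_bochner_integrable M (\<lambda>t. s k t *\<^sub>R z)" for k
      using simple_bochner_integrable_compose2[of "\<lambda>x y. x *\<^sub>R z", OF _ s(1)[of k] s(1)[of k]] by simp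
    have "(\<integral>\<^sup>+t. ennreal (p (g t *\<^sub>R z - s k t *\<^sub>R z)) \<partial>M) =
        ennreal (p z) * (\<integral>\<^sup>+t. ennreal (norm (g t - s k t)) \<partial>M)" for k
    proof -
      have "ennreal (p (g t *\<^sub>R z - s k t *\<^sub>R z)) = ennreal (p z) * ennreal (norm (g t - s k t))" for t
        using scale[OF z, of "g t - s k t"] nonneg[OF z]
        by (simp only: scaleR_diff_left ennreal_mult' mult.commute[of "p z"] real_norm_def)
          (simp add: mult.commute)
      then show ?thesis
        using gm sm[of k] by (simp add: nn_integral_cmult)
    qed
    then show "(\<lambda>k. \<integral>\<^sup>+t. ennreal (p (g t *\<^sub>R z - s k t *\<^sub>R z)) \<partial>M) \<longlonglongrightarrow> 0"
      using ennreal_tendsto_cmult[OF _ s(2), of "ennreal (p z)"] by simp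
    have "Bochner_Integration.simple_bochner_integral M (\<lambda>t. s k t *\<^sub>R z) =
        Bochner_Integration.simple_bochner_integral M (s k) *\<^sub>R z" for k
      by (rule simple_bochner_integral_linear[OF _ s(1)]) (auto intro!: linearI simp: scaleR_add_left)
    moreover have "(\<lambda>k. \<bar>Bochner_Integration.simple_bochner_integral M (s k) - (\<integral>t. g t \<partial>M)\<bar> * p z) \<longlonglongrightarrow> 0 * p z"
      using s(3) by (intro tendsto_intros tendsto_rabs_zero LIM_zero)
    ultimately show "(\<lambda>k. p (Bochner_Integration.simple_bochner_integral M (\<lambda>t. s k t *\<^sub>R z)
        - (\<integral>t. g t \<partial>M) *\<^sub>R z)) \<longlonglongrightarrow> 0"
      by (simp only: scale[OF z] scaleR_diff_left[symmetric] mult_zero_left)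
  qed (use z mem_simps(4) in blast)+
qed

lemma has_bochner_integral_in_sum_scaleR:
  fixes g :: "'i \<Rightarrow> 'a \<Rightarrow> real"
  assumes g: "\<And>a. a \<in> A \<Longrightarrow> integrable M (g a)" and z: "\<And>a. a \<in> A \<Longrightarrow> z a \<in> S"
    and M: "complete_measure M"
  shows "has_bochner_integral_in S p M (\<lambda>t. \<Sum>a\<in>A. g a t *\<^sub>R z a) (\<Sum>a\<in>A. (\<integral>t. g a t \<partial>M) *\<^sub>R z a)"
  using g z
proof (induction A rule: infinite_finite_induct)
  case (insert a A)
  have "has_bochner_integral_in S p M (\<lambda>t. g a t *\<^sub>R z a + (\<Sum>b\<in>A. g b t *\<^sub>R z b))
      ((\<integral>t. g a t \<partial>M) *\<^sub>R z a + (\<Sum>b\<in>A. (\<integral>t. g b t \<partial>M) *\<^sub>R z b))"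
    by (intro has_bochner_integral_in_add has_bochner_integral_in_scaleR insert M) auto
  then show ?case
    using insert.hyps by simp
qed (use has_bochner_integral_in_scaleR[of M "\<lambda>_. 0" 0] in simp_all)

end

section \<open>The K-functional\<close>

locale couple =
  fixes i :: "'x::banach \<Rightarrow> 'v::{real_vector,topological_ab_group_add,t2_space}"
    and j :: "'y::banach \<Rightarrow> 'v"
  assumes couple: "interpolation_couple i j"
begin

abbreviation "S \<equiv> sum_space i j"
abbreviation "K \<equiv> K_functional i j"

lemma linear_embeddings: "linear i" "linear j"
  using couple by (auto simp: interpolation_couple_def)

lemmas embedding_simps = linear_add[OF linear_embeddings(1)] linear_add[OF linear_embeddings(2)]
  linear_diff[OF linear_embeddings(1)] linear_diff[OF linear_embeddings(2)]
  linear_scale[OF linear_embeddings(1)] linear_scale[OF linear_embeddings(2)]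
  linear_0[OF linear_embeddings(1)] linear_0[OF linear_embeddings(2)]
  linear_neg[OF linear_embeddings(1)] linear_neg[OF linear_embeddings(2)]

lemma sum_spaceI: "i a + j b = x \<Longrightarrow> x \<in> S"
  unfolding sum_space_def by blast

lemma sum_spaceE:
  assumes "x \<in> S"
  obtains a b where "i a + j b = x"
  using assms unfolding sum_space_def by blast

lemma subspace_sum_space: "subspace S"
  unfolding subspace_def
proof (intro conjI ballI allI)
  show "0 \<in> S"
    by (rule sum_spaceI[of 0 0]) (simp add: embedding_simps)
  fix x c assume "x \<in> S"
  then obtain a b where x: "i a + j b = x" by (rule sum_spaceE)
  show "c *\<^sub>R x \<in> S"
    by (rule sum_spaceI[of "c *\<^sub>R a" "c *\<^sub>R b"]) (simp add: embedding_simps scaleR_add_right flip: x)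
  fix y assume "y \<in> S"
  then obtain a' b' where y: "i a' + j b' = y" by (rule sum_spaceE)
  show "x + y \<in> S"
    by (rule sum_spaceI[of "a + a'" "b + b'"]) (simp add: embedding_simps add_ac flip: x y)
qed

lemma bdd_below_K: "0 \<le> t \<Longrightarrow> bdd_below {norm a + t * norm b | a b. i a + j b = x}"
  by (intro bdd_belowI[of _ 0]) auto

lemma K_le: "0 \<le> t \<Longrightarrow> i a + j b = x \<Longrightarrow> K t x \<le> norm a + t * norm b"
  unfolding K_functional_def by (intro cInf_lower bdd_below_K) auto

lemma K_ge:
  assumes "x \<in> S" "\<And>a b. i a + j b = x \<Longrightarrow> B \<le> norm a + t * norm b"
  shows "B \<le> K t x"
proof -
  obtain a b where "i a + j b = x"
    using assms(1) by (rule sum_spaceE)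
  then show ?thesis
    unfolding K_functional_def using assms(2) by (intro cInf_greatest) blast+
qed

lemma K_nonneg: "0 \<le> t \<Longrightarrow> x \<in> S \<Longrightarrow> 0 \<le> K t x"
  by (rule K_ge) auto

lemma K_approx:
  assumes "x \<in> S" "K t x < B"
  obtains a b where "i a + j b = x" "norm a + t * norm b < B"
  using K_ge[of x B t] assms by (meson not_le)

lemma K_embedding_le: "0 \<le> t \<Longrightarrow> K t (i a) \<le> norm a" "0 \<le> t \<Longrightarrow> K t (j b) \<le> t * norm b"
  using K_le[of t a 0 "i a"] K_le[of t 0 b "j b"] by (simp_all add: embedding_simps)

lemma embedding_mem: "i a \<in> S" "j b \<in> S"
  using sum_spaceI[of a 0 "i a"] sum_spaceI[of 0 b "j b"] by (simp_all add: embedding_simps)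

text \<open>Scaling a decomposition of \<open>x\<close> decomposes the multiple. The opposite
  inequality follows in \<open>seminormed_K\<close> from this one, applied with
  \<open>1/c\<close>.\<close>

lemma K_scale_le:
  assumes t: "0 \<le> t" and x: "x \<in> S"
  shows "K t (c *\<^sub>R x) \<le> \<bar>c\<bar> * K t x"
proof (cases "c = 0")
  case True
  then show ?thesis using K_le[OF t, of 0 0 0] by (simp add: embedding_simps)
next
  case False
  have "K t (c *\<^sub>R x) / \<bar>c\<bar> \<le> K t x"
  proof (rule K_ge[OF x])
    fix a b assume ab: "i a + j b = x"
    have "K t (c *\<^sub>R x) \<le> norm (c *\<^sub>R a) + t * norm (c *\<^sub>R b)"
      by (rule K_le[OF t]) (simp add: embedding_simps scaleR_add_right flip: ab)
    also have "\<dots> = \<bar>c\<bar> * (norm a + t * norm b)"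
      by (simp add: algebra_simps)
    finally show "K t (c *\<^sub>R x) / \<bar>c\<bar> \<le> norm a + t * norm b"
      using False by (simp add: field_simps)
  qed
  then show ?thesis using False by (simp add: field_simps)
qed

lemma seminormed_K:
  assumes t: "0 \<le> t"
  shows "seminormed S (K t)"
proof
  show "subspace S" by (rule subspace_sum_space)
  fix x y assume x: "x \<in> S" and y: "y \<in> S"
  \<comment> \<open>Only one infimum can be bounded from below at a time, so the other summand is
    moved to the left, first for \<open>x\<close> and then for \<open>y\<close>.\<close>
  have "K t (x + y) - K t y \<le> K t x"
  proof (rule K_ge[OF x])
    fix a b assume ab: "i a + j b = x"
    have "K t (x + y) - (norm a + t * norm b) \<le> K t y"
    proof (rule K_ge[OF y])
      fix a' b' assume ab': "i a' + j b' = y"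
      have "K t (x + y) \<le> norm (a + a') + t * norm (b + b')"
        by (rule K_le[OF t]) (simp add: embedding_simps add_ac flip: ab ab')
      also have "\<dots> \<le> (norm a + norm a') + t * (norm b + norm b')"
        by (intro add_mono mult_left_mono norm_triangle_ineq t)
      finally show "K t (x + y) - (norm a + t * norm b) \<le> norm a' + t * norm b'"
        by (simp add: algebra_simps)
    qed
    then show "K t (x + y) - K t y \<le> norm a + t * norm b" by simp
  qed
  then show "K t (x + y) \<le> K t x + K t y" by simp
next
  fix x c assume x: "x \<in> S"
  show "K t (c *\<^sub>R x) = \<bar>c\<bar> * K t x"
  proof (rule antisym)
    show "K t (c *\<^sub>R x) \<le> \<bar>c\<bar> * K t x" by (rule K_scale_le[OF t x])
    show "\<bar>c\<bar> * K t x \<le> K t (c *\<^sub>R x)"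
    proof (cases "c = 0")
      case True
      then show ?thesis using K_nonneg[OF t subspace_0[OF subspace_sum_space]] by simp
    next
      case False
      then show ?thesis
        using K_scale_le[OF t subspace_scale[OF subspace_sum_space x, of c], of "1/c"]
        by (simp add: field_simps)
    qed
  qed
qed

text \<open>The sum norm thereby inherits every property proved for \<open>K t\<close>.\<close>

lemma sum_norm_eq_K: "sum_norm i j = K 1"
  by (simp add: fun_eq_iff sum_norm_def K_functional_def)

sublocale n: seminormed S "sum_norm i j"
  unfolding sum_norm_eq_K by (rule seminormed_K) simp

lemma K_mono:
  assumes "0 \<le> s" "s \<le> t" "x \<in> S"
  shows "K s x \<le> K t x"
proof (rule K_ge[OF assms(3)])
  fix a b assume "i a + j b = x"
  then have "K s x \<le> norm a + s * norm b" by (rule K_le[OF assms(1)])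
  also have "\<dots> \<le> norm a + t * norm b"
    by (intro add_left_mono mult_right_mono assms) simp
  finally show "K s x \<le> norm a + t * norm b" .
qed

text \<open>The same decomposition is tested at both parameters. This one bound yields that
  \<open>K t x / t\<close> is decreasing, that \<open>K\<close> at most doubles from
  \<open>s\<close> to \<open>2 * s\<close>, and that every \<open>K t\<close> is dominated by the
  sum norm.\<close>

lemma K_le_max:
  assumes s: "0 < s" and t: "0 \<le> t" and x: "x \<in> S"
  shows "K t x \<le> max 1 (t / s) * K s x"
proof -
  let ?m = "max 1 (t / s)"
  have "K t x / ?m \<le> K s x"
  proof (rule K_ge[OF x])
    fix a b assume "i a + j b = x"
    then have "K t x \<le> norm a + t * norm b" by (rule K_le[OF t])
    also have "\<dots> \<le> ?m * norm a + (?m * s) * norm b"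
    proof (intro add_mono mult_right_mono)
      show "norm a \<le> ?m * norm a"
        using mult_right_mono[of 1 ?m "norm a"] by simp
      show "t \<le> ?m * s"
        using s mult_right_mono[of "t / s" ?m s] by simp
    qed simp
    finally show "K t x / ?m \<le> norm a + s * norm b"
      by (simp add: divide_le_eq algebra_simps)
  qed
  then show ?thesis
    by (simp add: divide_le_eq mult.commute)
qed

lemma K_le_sum_norm: "0 \<le> t \<Longrightarrow> x \<in> S \<Longrightarrow> K t x \<le> max 1 t * sum_norm i j x"
  using K_le_max[of 1 t x] by (simp add: sum_norm_eq_K)

lemma sum_norm_embedding_le: "sum_norm i j (i a) \<le> norm a" "sum_norm i j (j b) \<le> norm b"
  using K_embedding_le[of 1] by (simp_all add: sum_norm_eq_K)

text \<open>Definiteness is where the Hausdorff ambient space enters.\<close>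

lemma sum_norm_eq_0D:
  assumes x: "x \<in> S" and 0: "sum_norm i j x = 0"
  shows "x = 0"
proof -
  have "\<exists>a b. i a + j b = x \<and> norm a + norm b < inverse (real (Suc k))" for k
  proof -
    have "K 1 x < inverse (real (Suc k))"
      using 0 by (simp add: sum_norm_eq_K)
    then show ?thesis
      using K_approx[OF x] by (metis mult_1)
  qed
  then obtain a b where ab: "\<And>k. i (a k) + j (b k) = x"
      and le: "\<And>k. norm (a k) + norm (b k) < inverse (real (Suc k))"
    by metis
  have "norm (a k) \<le> inverse (real (Suc k))" "norm (b k) \<le> inverse (real (Suc k))" for k
    using le[of k] norm_ge_zero[of "a k"] norm_ge_zero[of "b k"] by linarith+
  then have "a \<longlonglongrightarrow> 0" "b \<longlonglongrightarrow> 0"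
    by (auto intro: Lim_null_comparison[OF always_eventually LIMSEQ_inverse_real_of_nat])
  moreover have "isCont i 0" "isCont j 0"
    using couple by (auto simp: interpolation_couple_def continuous_on_eq_continuous_at)
  \<comment> \<open>These sums all equal \<open>x\<close>, so uniqueness of limits gives
    \<open>x = 0\<close>.\<close>
  ultimately have "(\<lambda>k. i (a k) + j (b k)) \<longlonglongrightarrow> i 0 + j 0"
    by (intro tendsto_add isCont_tendsto_compose[of 0 i] isCont_tendsto_compose[of 0 j])
  then have "(\<lambda>k. x) \<longlonglongrightarrow> 0"
    by (simp add: ab embedding_simps)
  then show ?thesis
    by (simp add: LIMSEQ_const_iff)
qed

text \<open>Makes \<open>2 * K t x\<close> strictly larger than the infimum \<open>K t x\<close>, as
  the choice of near optimal decompositions requires.\<close>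

lemma K_pos:
  assumes "0 < t" "x \<in> S" "x \<noteq> 0"
  shows "0 < K t x"
proof (rule ccontr)
  assume "\<not> 0 < K t x"
  then have "K t x = 0" using K_nonneg[of t x] assms by simp
  then have "sum_norm i j x \<le> 0"
    using K_le_max[of t 1 x] assms by (simp add: sum_norm_eq_K)
  then show False
    using sum_norm_eq_0D[OF assms(2)] n.nonneg[OF assms(2)] assms(3) by simp
qed

text \<open>Monotone in \<open>t\<close>, hence Borel. The ideal property of the function space
  requires measurability of the smaller function.\<close>

lemma K_borel_measurable:
  assumes x: "x \<in> S"
  shows "(\<lambda>t. K t x) \<in> borel_measurable halfline"
proof -
  have "mono_on {0..} (\<lambda>t. K t x)"
    using K_mono[OF _ _ x] by (auto intro!: mono_onI)
  then have "(\<lambda>t. K t x) \<in> borel_measurable (restrict_space borel {0..})"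
    by (intro borel_measurable_mono_on_fnc)
  \<comment> \<open>Extension by 0 to the whole line, where Borel functions are measurable for the
    completion.\<close>
  then have "(\<lambda>t. indicator {0..} t *\<^sub>R K t x) \<in> borel_measurable lborel"
    by (subst (asm) borel_measurable_restrict_space_iff) auto
  then show ?thesis
    by (subst borel_measurable_restrict_space_iff) (auto intro: measurable_completion)
qed

end

section \<open>A \<open>C^1\<close> step and its derivative\<close>

text \<open>The quadratic spline equal to \<open>2 r^2\<close> on \<open>[0,1/2]\<close> and to
  \<open>1 - 2 (1 - r)^2\<close> on \<open>[1/2,1]\<close>. Truncated powers reduce its
  differentiation to a single function.\<close>

definition smooth_step :: "real \<Rightarrow> real" where
  "smooth_step r = 2 * (max 0 r)\<^sup>2 - 4 * (max 0 (r - 1/2))\<^sup>2 + 2 * (max 0 (r - 1))\<^sup>2"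

text \<open>The derivative of \<open>smooth_step\<close>: a triangle over \<open>[0,1]\<close> with
  peak 2 at \<open>1/2\<close> and area 1.\<close>

definition tent :: "real \<Rightarrow> real" where
  "tent r = 4 * max 0 r - 8 * max 0 (r - 1/2) + 4 * max 0 (r - 1)"

lemma smooth_step_simps [simp]:
  "r \<le> 0 \<Longrightarrow> smooth_step r = 0" "1 \<le> r \<Longrightarrow> smooth_step r = 1"
  by (auto simp: smooth_step_def max_def power2_eq_square algebra_simps)

lemma tent_simps [simp]: "r \<le> 0 \<Longrightarrow> tent r = 0" "1 \<le> r \<Longrightarrow> tent r = 0"
  by (auto simp: tent_def max_def)

lemma tent_bounds: "0 \<le> tent r" "tent r \<le> 2"
  by (auto simp: tent_def max_def)

lemma continuous_tent: "continuous_on A tent"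
  unfolding tent_def by (intro continuous_intros)

lemma has_real_derivative_max_power2:
  "((\<lambda>r::real. (max 0 (r - c))\<^sup>2) has_real_derivative 2 * max 0 (x - c)) (at x)"
proof -
  consider "x < c" | "x = c" | "c < x" by linarith
  then show ?thesis
  proof cases
    case 1
    have "((\<lambda>r. 0) has_real_derivative 0) (at x)" by (rule DERIV_const)
    then have "((\<lambda>r::real. (max 0 (r - c))\<^sup>2) has_real_derivative 0) (at x)"
      by (rule has_field_derivative_transform_within_open[where S = "{..<c}"]) (use 1 in auto)
    then show ?thesis using 1 by simp
  next
    case 2
    \<comment> \<open>At the kink the difference quotient is at most the absolute value of
      \<open>h\<close>, because of the square.\<close>
    have "((\<lambda>h. (max 0 h)\<^sup>2 / h) \<longlongrightarrow> 0) (at (0::real))"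
    proof (rule Lim_null_comparison)
      show "\<forall>\<^sub>F h in at 0. norm ((max 0 h)\<^sup>2 / h) \<le> \<bar>h::real\<bar>"
        by (intro always_eventually) (auto simp: max_def power2_eq_square)
    qed (auto intro: tendsto_rabs_zero)
    then show ?thesis using 2 by (simp add: DERIV_def)
  next
    case 3
    have "((\<lambda>r. (r - c)\<^sup>2) has_real_derivative 2 * (x - c)) (at x)"
      by (auto intro!: derivative_eq_intros)
    then have "((\<lambda>r::real. (max 0 (r - c))\<^sup>2) has_real_derivative 2 * (x - c)) (at x)"
      by (rule has_field_derivative_transform_within_open[where S = "{c<..}"]) (use 3 in auto)
    then show ?thesis using 3 by simp
  qed
qed

lemma has_real_derivative_smooth_step:
  "(smooth_step has_real_derivative tent r) (at r)"
  unfolding smooth_step_def [abs_def] tent_def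
  using DERIV_add[OF DERIV_diff[OF DERIV_cmult[OF has_real_derivative_max_power2[of 0], of 2]
        DERIV_cmult[OF has_real_derivative_max_power2[of "1/2"], of 4]]
      DERIV_cmult[OF has_real_derivative_max_power2[of 1], of 2], of r]
  by simp

lemma smooth_step_mono: "mono smooth_step"
proof (rule monoI)
  fix x y :: real assume "x \<le> y"
  then show "smooth_step x \<le> smooth_step y"
    using has_real_derivative_smooth_step tent_bounds(1) by (blast intro: DERIV_nonneg_imp_nondecreasing)
qed

lemma smooth_step_bounds: "0 \<le> smooth_step r" "smooth_step r \<le> 1"
  using monoD[OF smooth_step_mono, of 0 r] monoD[OF smooth_step_mono, of r 1]
  by (cases "0 \<le> r"; cases "r \<le> 1"; simp)+

section \<open>From the trace method to the K-method\<close>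

lemma complete_halfline: "complete_measure halfline"
  by (rule complete_measure_lebesgue_on) simp

lemma borel_measurable_id_halfline: "(\<lambda>t. t) \<in> borel_measurable halfline"
  by (intro measurable_restrict_space1 measurable_completion) simp

section \<open>Smooth bumps and the weak derivative\<close>

text \<open>As \<open>f'\<close> vanishes off \<open>[a,b]\<close>, cutting it down to
  \<open>[a,b]\<close> or to the half line gives the same function, and completion does not change
  its integral.\<close>

lemma has_bochner_integral_halfline_FTC:
  fixes f f' :: "real \<Rightarrow> real"
  assumes ab: "0 \<le> a" "a \<le> b" and f: "\<And>t. (f has_real_derivative f' t) (at t)"
    and cont: "continuous_on UNIV f'" and supp: "\<And>t. t \<notin> {a..b} \<Longrightarrow> f' t = 0"
  shows "has_bochner_integral halfline f' (f b - f a)"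
proof -
  have "has_bochner_integral lborel (\<lambda>x. f' x * indicator {a..b} x) (f b - f a)"
    using f cont by (intro has_bochner_integral_FTC_Icc_real ab)
      (auto simp: continuous_on_eq_continuous_at intro: has_field_derivative_at_within)
  moreover have "f' x * indicator {a..b} x = indicator {0..} x *\<^sub>R f' x" for x
    using supp[of x] ab by (auto simp: indicator_def)
  ultimately have "has_bochner_integral lborel (\<lambda>x. indicator {0..} x *\<^sub>R f' x) (f b - f a)"
    by simp
  then show ?thesis
    by (auto simp: has_bochner_integral_iff integrable_restrict_space integral_restrict_space
        integrable_completion integral_completion)
qed

lemma has_real_derivative_smooth_step_scaled:
  assumes "0 < d"
  shows "((\<lambda>s. smooth_step ((s - a) / d)) has_real_derivative tent ((t - a) / d) / d) (at t)"
proof -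
  have "((\<lambda>s. (s - a) / d) has_real_derivative 1 / d) (at t)"
    using assms by (auto intro!: derivative_eq_intros)
  from DERIV_chain2[OF has_real_derivative_smooth_step this] show ?thesis by simp
qed

lemma continuous_on_tent_scaled: "0 < d \<Longrightarrow> continuous_on A (\<lambda>s. tent ((s - a) / d) / d)"
  by (intro continuous_on_divide continuous_on_compose2[OF continuous_tent] continuous_intros) auto

text \<open>A bump of mass 1 supported in \<open>[a, a + d]\<close>; averaging a continuous function
  against it approximates a point value for small \<open>d\<close>.\<close>

lemma smooth_step_shift_integral:
  assumes "0 \<le> a" "0 < d"
  shows "has_bochner_integral halfline (\<lambda>s. tent ((s - a) / d) / d) 1"
proof -
  have "has_bochner_integral halfline (\<lambda>s. tent ((s - a) / d) / d)
      (smooth_step ((a + d - a) / d) - smooth_step ((a - a) / d))"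
  proof (rule has_bochner_integral_halfline_FTC[where f = "\<lambda>s. smooth_step ((s - a) / d)"])
    show "((\<lambda>s. smooth_step ((s - a) / d)) has_real_derivative tent ((t - a) / d) / d) (at t)" for t
      using assms(2) by (rule has_real_derivative_smooth_step_scaled)
    show "continuous_on UNIV (\<lambda>s. tent ((s - a) / d) / d)"
      using assms(2) by (rule continuous_on_tent_scaled)
    show "tent ((t - a) / d) / d = 0" if "t \<notin> {a..a + d}" for t
      using that assms(2) by (cases "t < a") (auto simp: field_simps)
  qed (use assms in auto)
  then show ?thesis using assms(2) by simp
qed

context seminormed
begin

text \<open>
  Testing the weak derivative with a smooth approximation of the indicator function of
  \<open>[0,t]\<close> replaces the fundamental theorem of calculus.
\<close>

lemma weak_derivative_seminorm_le:
  assumes n: "seminormed S n" and le: "\<And>x. x \<in> S \<Longrightarrow> p x \<le> C * n x" and C: "0 \<le> C"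
    and uv: "W11_loc_in S n u v" and t: "0 < t"
  shows "ennreal (p (u 0 - u t)) \<le> (\<integral>\<^sup>+s. ennreal (p (v s)) * indicator {0..t} s \<partial>halfline)"
    (is "_ \<le> ?J")
proof -
  interpret n: seminormed S n by fact
  have uS: "u s \<in> S" and vS: "v s \<in> S" if "0 \<le> s" for s
    using uv that n.strongly_measurable_in_mem[of halfline]
    by (auto simp: W11_loc_in_def locally_integrable_in_def)
  have lim: "((\<lambda>s. n (u s - u t)) \<longlongrightarrow> 0) (at t within {0..})" if "0 \<le> t" for t
    using uv that by (auto simp: W11_loc_in_def)
  have near: "\<exists>d>0. \<forall>s\<ge>0. \<bar>s - t\<bar> \<le> d \<longrightarrow> n (u s - u t) \<le> e" if "0 \<le> t" "0 < e" for t e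
  proof -
    have "\<forall>\<^sub>F s in at t within {0..}. n (u s - u t) < e"
      using order_tendstoD(2)[OF lim] that by blast
    then obtain d where d: "0 < d" "\<And>s. 0 \<le> s \<Longrightarrow> s \<noteq> t \<Longrightarrow> \<bar>s - t\<bar> < d \<Longrightarrow> n (u s - u t) < e"
      unfolding eventually_at by (auto simp: dist_real_def)
    have "n (u s - u t) \<le> e" if s: "0 \<le> s" "\<bar>s - t\<bar> \<le> d / 2" for s
      using d(1) d(2)[OF s(1)] s(2) \<open>0 < e\<close> by (cases "s = t") fastforce+
    then show ?thesis using d(1) by (intro exI[of _ "d / 2"]) auto
  qed
  have "ennreal (p (u 0 - u t)) \<le> ?J + ennreal (2 * (C * e))" if e: "0 < e" for e
  proof -
    obtain d1 where d1: "0 < d1" "\<And>s. 0 \<le> s \<Longrightarrow> \<bar>s - 0\<bar> \<le> d1 \<Longrightarrow> n (u s - u 0) \<le> e"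
      using near[of 0 e] e by blast
    obtain d2 where d2: "0 < d2" "\<And>s. 0 \<le> s \<Longrightarrow> \<bar>s - t\<bar> \<le> d2 \<Longrightarrow> n (u s - u t) \<le> e"
      using near[of t e] e t by auto
    \<comment> \<open>\<open>\<phi>\<close> rises on \<open>[d, 2 * d]\<close> with slope
      \<open>g1\<close> and falls on \<open>[t - d, t]\<close> with slope \<open>- g2\<close>. The
      three bounds on \<open>d\<close> keep \<open>u\<close> within \<open>e\<close> of
      \<open>u 0\<close> on the first interval and of \<open>u t\<close> on the second, and order
      the two intervals.\<close>
    define d where "d = min (d1 / 2) (min d2 (t / 3))"
    have d: "0 < d" "2 * d \<le> d1" "d \<le> d2" "3 * d \<le> t"
      using d1(1) d2(1) t by (auto simp: d_def)
    define g1 where "g1 s = tent ((s - d) / d) / d" for s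
    define g2 where "g2 s = tent ((s - (t - d)) / d) / d" for s
    define \<phi> where "\<phi> s = smooth_step ((s - d) / d) - smooth_step ((s - (t - d)) / d)" for s
    have g: "0 \<le> g1 s" "0 \<le> g2 s" for s
      using d tent_bounds by (auto simp: g1_def g2_def)
    have g1: "has_bochner_integral halfline g1 1" and g2: "has_bochner_integral halfline g2 1"
      unfolding g1_def [abs_def] g2_def [abs_def] using d by (auto intro!: smooth_step_shift_integral)
    have \<phi>_out: "\<phi> s = 0" if "s \<notin> {d..t}" for s
      using that d by (cases "s < d") (auto simp: \<phi>_def field_simps)
    have \<phi>_le: "\<bar>\<phi> s\<bar> \<le> 1" for s
      using smooth_step_bounds[of "(s - d) / d"] smooth_step_bounds[of "(s - (t - d)) / d"]
      unfolding \<phi>_def by linarith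
    have "test_function \<phi> (\<lambda>s. g1 s - g2 s)"
      unfolding test_function_def
    proof (intro conjI allI)
      fix s
      show "(\<phi> has_real_derivative g1 s - g2 s) (at s)"
        unfolding \<phi>_def [abs_def] g1_def g2_def using d(1)
        by (intro DERIV_diff has_real_derivative_smooth_step_scaled)
      show "continuous_on UNIV (\<lambda>s. g1 s - g2 s)"
        unfolding g1_def [abs_def] g2_def [abs_def] using d(1)
        by (intro continuous_on_diff continuous_on_tent_scaled)
      show "\<exists>a>0. \<exists>b. \<forall>t. t \<notin> {a..b} \<longrightarrow> \<phi> t = 0"
        using d(1) \<phi>_out by blast
    qed
    then obtain z where z: "has_bochner_integral_in S n halfline (\<lambda>s. (g1 s - g2 s) *\<^sub>R u s) z"
      and z': "has_bochner_integral_in S n halfline (\<lambda>s. \<phi> s *\<^sub>R v s) (- z)"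
      using uv unfolding W11_loc_in_def weak_derivative_in_def by blast
    have zS: "z \<in> S"
      using z by (auto simp: has_bochner_integral_in_def)
    have "ennreal (p (- z)) \<le> (\<integral>\<^sup>+s. ennreal (p (\<phi> s *\<^sub>R v s)) \<partial>halfline)"
      by (rule has_bochner_integral_in_seminorm_le[OF z' complete_halfline n le C])
    also have "\<dots> \<le> ?J"
    proof (rule nn_integral_mono)
      fix s assume "s \<in> space halfline"
      then have s: "0 \<le> s" by simp
      show "ennreal (p (\<phi> s *\<^sub>R v s)) \<le> ennreal (p (v s)) * indicator {0..t} s"
      proof (cases "s \<in> {d..t}")
        case True
        have "p (\<phi> s *\<^sub>R v s) \<le> p (v s)"
          using mult_right_mono[OF \<phi>_le nonneg[OF vS[OF s]]] by (simp add: scale vS s)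
        then show ?thesis using True s by (simp add: ennreal_leI)
      qed (simp add: \<phi>_out)
    qed
    finally have 1: "ennreal (p z) \<le> ?J" using zS by simp
    \<comment> \<open>Since both bumps have mass 1, the constants can be put under the integral:
      \<open>z - (u 0 - u t)\<close> is the mean of \<open>u - u 0\<close> against \<open>g1\<close>
      minus that of \<open>u - u t\<close> against \<open>g2\<close>. Each mean has seminorm at most
      \<open>C * e\<close>.\<close>
    have "has_bochner_integral_in S n halfline
        (\<lambda>s. (g1 s - g2 s) *\<^sub>R u s + (g1 s *\<^sub>R (- u 0) + g2 s *\<^sub>R u t))
        (z + ((\<integral>s. g1 s \<partial>halfline) *\<^sub>R (- u 0) + (\<integral>s. g2 s \<partial>halfline) *\<^sub>R u t))"
      using g1 g2 uS[of 0] uS[of t] t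
      by (intro n.has_bochner_integral_in_add n.has_bochner_integral_in_scaleR z complete_halfline)
        (auto simp: has_bochner_integral_iff)
    then have "has_bochner_integral_in S n halfline
        (\<lambda>s. (g1 s - g2 s) *\<^sub>R u s + (g1 s *\<^sub>R (- u 0) + g2 s *\<^sub>R u t)) (z + (- u 0 + u t))"
      using g1 g2 by (simp add: has_bochner_integral_iff)
    from has_bochner_integral_in_seminorm_le[OF this complete_halfline n le C]
    have "ennreal (p (z + (- u 0 + u t))) \<le>
        (\<integral>\<^sup>+s. ennreal (p ((g1 s - g2 s) *\<^sub>R u s + (g1 s *\<^sub>R (- u 0) + g2 s *\<^sub>R u t))) \<partial>halfline)" .
    also have "\<dots> \<le> (\<integral>\<^sup>+s. ennreal (C * e * (g1 s + g2 s)) \<partial>halfline)"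
    proof (rule nn_integral_mono, rule ennreal_leI)
      fix s assume "s \<in> space halfline"
      then have s: "0 \<le> s" by simp
      have mem: "u s - u 0 \<in> S" "u s - u t \<in> S"
        using uS s t by auto
      have "n (u s - u 0) \<le> e" if "g1 s \<noteq> 0"
      proof -
        have "(s - d) / d \<le> 1" using that by (auto simp: g1_def intro: ccontr)
        then show ?thesis using d d1(2) s by (auto simp: field_simps)
      qed
      then have b1: "g1 s * p (u s - u 0) \<le> g1 s * (C * e)"
        using le[OF mem(1)] g(1)[of s] C mult_left_mono[of "n (u s - u 0)" e C]
        by (cases "g1 s = 0") (auto intro!: mult_left_mono)
      have "n (u s - u t) \<le> e" if "g2 s \<noteq> 0"
      proof -
        have "0 \<le> (s - (t - d)) / d" "(s - (t - d)) / d \<le> 1"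
          using that by (auto simp: g2_def intro: ccontr)
        then show ?thesis using d d2(2)[OF s] by (auto simp: field_simps)
      qed
      then have b2: "g2 s * p (u s - u t) \<le> g2 s * (C * e)"
        using le[OF mem(2)] g(2)[of s] C mult_left_mono[of "n (u s - u t)" e C]
        by (cases "g2 s = 0") (auto intro!: mult_left_mono)
      have "(g1 s - g2 s) *\<^sub>R u s + (g1 s *\<^sub>R (- u 0) + g2 s *\<^sub>R u t)
          = g1 s *\<^sub>R (u s - u 0) - g2 s *\<^sub>R (u s - u t)"
        by (simp add: algebra_simps)
      also have "p \<dots> \<le> g1 s * p (u s - u 0) + g2 s * p (u s - u t)"
        using triangle_diff[of "g1 s *\<^sub>R (u s - u 0)" "g2 s *\<^sub>R (u s - u t)"] mem g[of s]
        by (simp add: scale)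
      also have "\<dots> \<le> C * e * (g1 s + g2 s)"
        using b1 b2 by (simp add: algebra_simps)
      finally show "p ((g1 s - g2 s) *\<^sub>R u s + (g1 s *\<^sub>R (- u 0) + g2 s *\<^sub>R u t)) \<le> C * e * (g1 s + g2 s)" .
    qed
    also have "\<dots> = ennreal (2 * (C * e))"
    proof -
      have "has_bochner_integral halfline (\<lambda>s. C * e * (g1 s + g2 s)) (C * e * (1 + 1))"
        by (intro has_bochner_integral_mult_right has_bochner_integral_add g1 g2)
      then show ?thesis
        using g C e by (subst nn_integral_eq_integral) (auto simp: has_bochner_integral_iff mult.commute)
    qed
    finally have 2: "ennreal (p (z + (- u 0 + u t))) \<le> ennreal (2 * (C * e))" .
    have "p (u 0 - u t) \<le> p z + p (z + (- u 0 + u t))"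
      using triangle_diff[of z "z + (- u 0 + u t)"] zS uS t by simp
    then have "ennreal (p (u 0 - u t)) \<le> ennreal (p z) + ennreal (p (z + (- u 0 + u t)))"
      using zS uS t by (intro ennreal_le_plusI) auto
    then show ?thesis using add_mono[OF 1 2] by (rule order_trans)
  qed
  note bound = this
  \<comment> \<open>\<open>e\<close> was arbitrary and the integral \<open>?J\<close> does not
    depend on it.\<close>
  have "((\<lambda>e. ?J + ennreal (2 * (C * e))) \<longlongrightarrow> ?J + ennreal (2 * (C * 0))) (at_right 0)"
    by (intro tendsto_intros)
  moreover have "\<forall>\<^sub>F e in at_right 0. ennreal (p (u 0 - u t)) \<le> ?J + ennreal (2 * (C * e))"
    using bound by (auto simp: eventually_at_filter)
  ultimately show ?thesis
    by (intro tendsto_lowerbound[where F="at_right (0::real)"]) auto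
qed

end

section \<open>The Hardy operator bounds the K-functional of a trace\<close>

lemma hardy_of_real: "hardy (\<lambda>s. complex_of_real (f s)) t = complex_of_real ((\<integral>s. f s \<partial>lebesgue_on {0..t}) / t)"
  by (simp add: hardy_def scaleR_conv_of_real)

lemma nn_integral_halfline_Icc:
  fixes f :: "real \<Rightarrow> real"
  assumes f: "integrable (lebesgue_on {0..t}) f" and nonneg: "\<And>s. 0 \<le> f s"
  shows "(\<integral>\<^sup>+s. ennreal (f s) * indicator {0..t} s \<partial>halfline) = ennreal (\<integral>s. f s \<partial>lebesgue_on {0..t})"
proof -
  have "(\<integral>\<^sup>+s. ennreal (f s) * indicator {0..t} s \<partial>halfline) =
      (\<integral>\<^sup>+s. ennreal (f s) * indicator {0..t} s * indicator {0..} s \<partial>lebesgue)"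
    by (simp add: nn_integral_restrict_space)
  also have "\<dots> = (\<integral>\<^sup>+s. ennreal (f s) * indicator {0..t} s \<partial>lebesgue)"
    by (intro nn_integral_cong) (auto split: split_indicator)
  also have "\<dots> = (\<integral>\<^sup>+s. ennreal (f s) \<partial>lebesgue_on {0..t})"
    by (simp add: nn_integral_restrict_space)
  also have "\<dots> = ennreal (\<integral>s. f s \<partial>lebesgue_on {0..t})"
    using f nonneg by (intro nn_integral_eq_integral) auto
  finally show ?thesis .
qed

locale function_space =
  fixes \<Phi> :: "(real \<Rightarrow> complex) set" and N :: "(real \<Rightarrow> complex) \<Rightarrow> real"
  assumes function_space: "banach_function_space \<Phi> N"
    and hardy_bounded: "hardy_bounded_on \<Phi> N"
begin

lemmas axioms = function_space[unfolded banach_function_space_def]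

lemma
  shows add: "f \<in> \<Phi> \<Longrightarrow> g \<in> \<Phi> \<Longrightarrow> (\<lambda>t. f t + g t) \<in> \<Phi>"
    and norm_add: "f \<in> \<Phi> \<Longrightarrow> g \<in> \<Phi> \<Longrightarrow> N (\<lambda>t. f t + g t) \<le> N f + N g"
  using axioms[THEN conjunct2, THEN conjunct2, THEN conjunct1] by simp_all

lemma
  shows scale: "f \<in> \<Phi> \<Longrightarrow> (\<lambda>t. c * f t) \<in> \<Phi>"
    and norm_scale: "f \<in> \<Phi> \<Longrightarrow> N (\<lambda>t. c * f t) = cmod c * N f"
  using axioms[THEN conjunct2, THEN conjunct2, THEN conjunct2, THEN conjunct1] by simp_all

lemma norm_nonneg: "f \<in> \<Phi> \<Longrightarrow> 0 \<le> N f"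
  using axioms[THEN conjunct2, THEN conjunct2, THEN conjunct2, THEN conjunct2, THEN conjunct1] by simp

lemma
  assumes "g \<in> \<Phi>" "f \<in> borel_measurable halfline" "AE t in halfline. cmod (f t) \<le> cmod (g t)"
  shows ideal: "f \<in> \<Phi>" and ideal_norm: "N f \<le> N g"
  using axioms[THEN conjunct2, THEN conjunct2, THEN conjunct2, THEN conjunct2, THEN conjunct2,
      THEN conjunct2, THEN conjunct2] assms by simp_all

lemma hardy_mem: "f \<in> \<Phi> \<Longrightarrow> hardy f \<in> \<Phi>"
  using hardy_bounded by (auto simp: hardy_bounded_on_def)

lemma integrable_Icc: "f \<in> \<Phi> \<Longrightarrow> 0 \<le> t \<Longrightarrow> integrable (lebesgue_on {0..t}) f"
  using hardy_bounded by (auto simp: hardy_bounded_on_def L1_loc_def)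

lemma integrable_real_Icc:
  "(\<lambda>s. complex_of_real (f s)) \<in> \<Phi> \<Longrightarrow> 0 \<le> t \<Longrightarrow> integrable (lebesgue_on {0..t}) f"
  using integrable_Icc[of "\<lambda>s. complex_of_real (f s)" t] by (simp add: complex_of_real_integrable_eq)

end

locale function_space_couple = couple i j + function_space \<Phi> N
  for i :: "'x::banach \<Rightarrow> 'v::{real_vector,topological_ab_group_add,t2_space}"
    and j :: "'y::banach \<Rightarrow> 'v" and \<Phi> N
begin

lemma K_le_hardy:
  assumes data: "W1_data \<Phi> i j u y w"
  shows "AE t in halfline. K t (u 0) / t \<le> (\<integral>s. norm (w s) \<partial>lebesgue_on {0..t}) / t + norm (y t)"
proof -
  have W: "W11_loc_in S (sum_norm i j) u (\<lambda>t. i (w t))"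
    and eq: "AE t in halfline. u t = j (y t)" and w: "(\<lambda>t. complex_of_real (norm (w t))) \<in> \<Phi>"
    using data by (auto simp: W1_data_def bochner_space_def)
  have uS: "u s \<in> S" if "0 \<le> s" for s
    using W that n.strongly_measurable_in_mem[of halfline]
    by (auto simp: W11_loc_in_def locally_integrable_in_def)
  show ?thesis
    using eq AE_space
  proof eventually_elim
    case (elim t)
    then have "0 \<le> t" by simp
    show ?case
    \<comment> \<open>At \<open>t = 0\<close> both quotients are 0, as division by 0 yields
      0.\<close>
    proof (cases "t = 0")
      case False
      with \<open>0 \<le> t\<close> have t: "0 < t" by simp
      interpret K: seminormed S "K t"
        using \<open>0 \<le> t\<close> by (rule seminormed_K)
      let ?I = "\<integral>s. norm (w s) \<partial>lebesgue_on {0..t}"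
      have "ennreal (K t (u 0 - u t)) \<le> (\<integral>\<^sup>+s. ennreal (K t (i (w s))) * indicator {0..t} s \<partial>halfline)"
        by (rule K.weak_derivative_seminorm_le[OF n.seminormed_axioms K_le_sum_norm _ W t]) (use t in auto)
      also have "\<dots> \<le> (\<integral>\<^sup>+s. ennreal (norm (w s)) * indicator {0..t} s \<partial>halfline)"
        using K_embedding_le(1) t by (intro nn_integral_mono mult_right_mono ennreal_leI) auto
      also have "\<dots> = ennreal ?I"
        by (rule nn_integral_halfline_Icc[OF integrable_real_Icc[OF w]]) (use t in auto)
      finally have "K t (u 0 - u t) \<le> ?I"
        by (simp add: ennreal_le_iff)
      moreover have "K t (u t) \<le> t * norm (y t)"
        using K_embedding_le(2) t elim by simp
      moreover have "K t (u 0) \<le> K t (u t) + K t (u 0 - u t)"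
        using uS t by (intro K.triangle_add) auto
      ultimately show ?thesis
        using t by (simp add: field_simps)
    qed simp
  qed
qed

text \<open>A single use of the ideal property, with the pointwise bound \<open>K_le_hardy\<close>,
  gives both membership and the norm estimate.\<close>

lemma
  assumes C: "\<And>f. f \<in> \<Phi> \<Longrightarrow> N (hardy f) \<le> C * N f" and data: "W1_data \<Phi> i j u y w"
  shows trace_mem_K_space: "u 0 \<in> K_space \<Phi> i j"
    and K_norm_trace_le: "K_norm N i j (u 0) \<le> C * bochner_norm N w + bochner_norm N y"
proof -
  let ?w = "\<lambda>t. complex_of_real (norm (w t))" and ?y = "\<lambda>t. complex_of_real (norm (y t))"
  let ?k = "\<lambda>t. complex_of_real (K t (u 0) / t)"
  have w: "?w \<in> \<Phi>" and y: "?y \<in> \<Phi>" and u0: "u 0 \<in> S"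
    using data n.strongly_measurable_in_mem[of halfline u 0]
    by (auto simp: W1_data_def bochner_space_def W11_loc_in_def locally_integrable_in_def)
  have g: "(\<lambda>t. hardy ?w t + ?y t) \<in> \<Phi>"
    using hardy_mem[OF w] y by (rule add)
  have k: "?k \<in> borel_measurable halfline"
    using K_borel_measurable[OF u0] borel_measurable_id_halfline by measurable
  have "AE t in halfline. cmod (?k t) \<le> cmod (hardy ?w t + ?y t)"
    using K_le_hardy[OF data] AE_space
  proof eventually_elim
    case (elim t)
    then show ?case
      using K_nonneg[of t, OF _ u0]
      by (simp add: hardy_of_real del: of_real_divide of_real_add flip: of_real_add)
  qed
  note ideal = ideal[OF g k this] ideal_norm[OF g k this]
  show "u 0 \<in> K_space \<Phi> i j"
    using ideal(1) u0 by (simp add: K_space_def)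
  have "K_norm N i j (u 0) \<le> N (hardy ?w) + N ?y"
    using ideal(2) norm_add[OF hardy_mem[OF w] y] by (simp add: K_norm_def)
  then show "K_norm N i j (u 0) \<le> C * bochner_norm N w + bochner_norm N y"
    using C[OF w] by (simp add: bochner_norm_def)
qed

end

section \<open>From the K-method to the trace method\<close>

lemma test_function_derivative_outside:
  assumes "\<And>t. (\<phi> has_real_derivative \<phi>' t) (at t)" "\<And>t. t \<notin> {a..b} \<Longrightarrow> \<phi> t = 0" "t \<notin> {a..b}"
  shows "\<phi>' t = (0::real)"
proof -
  have "(\<phi> has_real_derivative 0) (at t)"
    using assms(2,3)
    by (intro has_field_derivative_transform_within_open[OF DERIV_const, where S = "- {a..b}"])
      (auto simp: open_Compl)
  then show ?thesis using DERIV_unique[OF assms(1)] by blast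
qed

lemma integrable_halfline_continuous:
  fixes f :: "real \<Rightarrow> real"
  assumes cont: "continuous_on UNIV f" and supp: "\<And>t. t \<notin> {a..b} \<Longrightarrow> f t = 0"
  shows "integrable halfline f"
proof -
  have "set_integrable lborel {a..b} f"
    using cont by (intro borel_integrable_atLeastAtMost') (rule continuous_on_subset, auto)
  then have "integrable lborel (\<lambda>t. indicator {a..b} t *\<^sub>R f t)"
    by (simp add: set_integrable_def)
  moreover have "(\<lambda>t. indicator {a..b} t *\<^sub>R f t) = f"
  proof (rule ext)
    fix t
    show "indicator {a..b} t *\<^sub>R f t = f t"
      using supp[of t] by (cases "t \<in> {a..b}") auto
  qed
  ultimately have "integrable lebesgue f"
    by (simp add: integrable_completion)
  then show ?thesis
    using integrable_mult_indicator[of "{0..}" lebesgue f] by (simp add: integrable_restrict_space)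
qed

lemma integral_by_parts_test_function:
  fixes h h' :: "real \<Rightarrow> real"
  assumes \<phi>: "test_function \<phi> \<phi>'" and h: "\<And>t. (h has_real_derivative h' t) (at t)"
    and h': "continuous_on UNIV h'"
  shows "integrable halfline (\<lambda>t. \<phi>' t * h t)" "integrable halfline (\<lambda>t. \<phi> t * h' t)"
    "(\<integral>t. \<phi>' t * h t \<partial>halfline) = - (\<integral>t. \<phi> t * h' t \<partial>halfline)"
proof -
  obtain a b where der: "\<And>t. (\<phi> has_real_derivative \<phi>' t) (at t)" and cont: "continuous_on UNIV \<phi>'"
    and a: "0 < a" and supp: "\<And>t. t \<notin> {a..b} \<Longrightarrow> \<phi> t = 0"
    using \<phi> unfolding test_function_def by blast
  have supp': "\<phi>' t = 0" if "t \<notin> {a..b}" for t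
    using test_function_derivative_outside[OF der supp that] .
  have c: "continuous_on UNIV \<phi>" "continuous_on UNIV h"
    using DERIV_isCont[OF der] DERIV_isCont[OF h] by (simp_all add: continuous_at_imp_continuous_on)
  show 1: "integrable halfline (\<lambda>t. \<phi>' t * h t)"
    using supp' by (intro integrable_halfline_continuous[of _ a b] continuous_on_mult cont c) auto
  show 2: "integrable halfline (\<lambda>t. \<phi> t * h' t)"
    using supp by (intro integrable_halfline_continuous[of _ a b] continuous_on_mult h' c) auto
  \<comment> \<open>\<open>a / 2\<close> and \<open>?b\<close> lie strictly outside
    \<open>[a,b]\<close>, so the boundary terms vanish; \<open>max\<close> takes care of
    \<open>b < a\<close>, and \<open>a / 2\<close> is still in the half line.\<close>
  let ?b = "max a b + 1"
  have "has_bochner_integral halfline (\<lambda>t. \<phi>' t * h t + \<phi> t * h' t)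
      (\<phi> ?b * h ?b - \<phi> (a / 2) * h (a / 2))"
  proof (rule has_bochner_integral_halfline_FTC[where f = "\<lambda>t. \<phi> t * h t"])
    show "((\<lambda>t. \<phi> t * h t) has_real_derivative \<phi>' t * h t + \<phi> t * h' t) (at t)" for t
      using DERIV_mult[OF der h, of t] by (simp add: mult_ac)
    show "continuous_on UNIV (\<lambda>t. \<phi>' t * h t + \<phi> t * h' t)"
      by (intro continuous_on_add continuous_on_mult cont c h')
    show "\<phi>' t * h t + \<phi> t * h' t = 0" if "t \<notin> {a / 2..?b}" for t
    proof -
      have "t \<notin> {a..b}" using that a by auto
      then show ?thesis using supp supp' by simp
    qed
  qed (use a in auto)
  moreover have "\<phi> ?b = 0" "\<phi> (a / 2) = 0"
    using a by (auto intro!: supp)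
  ultimately have "(\<integral>t. \<phi>' t * h t + \<phi> t * h' t \<partial>halfline) = 0"
    by (simp add: has_bochner_integral_iff)
  then show "(\<integral>t. \<phi>' t * h t \<partial>halfline) = - (\<integral>t. \<phi> t * h' t \<partial>halfline)"
    using 1 2 by (simp add: add_eq_0_iff2)
qed

text \<open>The point 0, where quotients by \<open>t\<close> and logarithms carry no meaning, is a
  null set.\<close>

lemma AE_lebesgue_on_pos:
  fixes S :: "real set"
  assumes "S \<in> sets lebesgue" "S \<subseteq> {0..}"
  shows "AE t in lebesgue_on S. 0 < t"
proof -
  have "AE t in lebesgue. t \<noteq> (0::real)"
    by (rule AE_completion) (rule AE_lborel_singleton)
  then show ?thesis
    using assms by (subst AE_restrict_space_iff) (auto elim!: eventually_mono)
qed

lemma AE_halfline_pos: "AE t in halfline. 0 < t"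
  by (rule AE_lebesgue_on_pos) auto

lemma AE_lebesgue_on_Icc_pos: "AE t in lebesgue_on {0..T}. 0 < (t::real)"
  by (rule AE_lebesgue_on_pos) auto

lemma borel_measurable_halfline_Icc:
  "f \<in> borel_measurable halfline \<Longrightarrow> f \<in> borel_measurable (lebesgue_on {0..T})"
  by (rule measurable_restrict_mono) auto

section \<open>The dyadic scale\<close>

lemma sum_telescope_int:
  fixes f :: "int \<Rightarrow> 'a::ab_group_add"
  assumes "M \<le> m"
  shows "(\<Sum>n\<in>{M..<m}. f (n + 1) - f n) = f m - f M"
  using assms
proof (induction m rule: int_ge_induct)
  case (step m)
  have "{M..<m + 1} = insert m {M..<m}"
    using step.hyps by auto
  then show ?case using step.IH by simp
qed simp

definition dyadic :: "int \<Rightarrow> real" where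
  "dyadic n = 2 powr real_of_int n"

definition dyadic_index :: "real \<Rightarrow> int" where
  "dyadic_index t = \<lfloor>log 2 t\<rfloor>"

lemma dyadic_pos [simp]: "0 < dyadic n" "0 \<le> dyadic n" "dyadic n \<noteq> 0"
  by (auto simp: dyadic_def)

lemma dyadic_Suc: "dyadic (n + 1) = 2 * dyadic n"
  by (simp add: dyadic_def powr_add)

lemma dyadic_mono: "m \<le> n \<Longrightarrow> dyadic m \<le> dyadic n"
  by (simp add: dyadic_def)

lemma dyadic_index_bounds:
  assumes "0 < t"
  shows "dyadic (dyadic_index t) \<le> t" "t < 2 * dyadic (dyadic_index t)"
  using floor_log_eq_powr_iff[of t 2 "dyadic_index t"] assms
  by (auto simp: dyadic_def dyadic_index_def powr_add)

lemma dyadic_index_mono: "0 < s \<Longrightarrow> s \<le> t \<Longrightarrow> dyadic_index s \<le> dyadic_index t"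
  by (auto simp: dyadic_index_def intro: floor_mono)

text \<open>The transition takes place on \<open>[dyadic n, dyadic (n + 1)]\<close>, an interval of
  length \<open>dyadic n\<close>, so that only one step is in transition at a time.\<close>

definition dyadic_step :: "int \<Rightarrow> real \<Rightarrow> real" where
  "dyadic_step n t = smooth_step ((t - dyadic n) / dyadic n)"

definition dyadic_tent :: "int \<Rightarrow> real \<Rightarrow> real" where
  "dyadic_tent n t = tent ((t - dyadic n) / dyadic n) / dyadic n"

lemma has_real_derivative_dyadic_step:
  "(dyadic_step n has_real_derivative dyadic_tent n t) (at t)"
  unfolding dyadic_step_def [abs_def] dyadic_tent_def
  by (intro has_real_derivative_smooth_step_scaled) simp

lemma continuous_on_dyadic_tent: "continuous_on A (dyadic_tent n)"
  unfolding dyadic_tent_def [abs_def] by (intro continuous_on_tent_scaled) simp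

lemma dyadic_step_bounds: "0 \<le> dyadic_step n t" "dyadic_step n t \<le> 1"
  by (auto simp: dyadic_step_def smooth_step_bounds)

lemma dyadic_tent_bounds: "0 \<le> dyadic_tent n t" "dyadic_tent n t \<le> 2 / dyadic n"
  by (auto simp: dyadic_tent_def tent_bounds intro: divide_right_mono)

text \<open>Steps of smaller index are complete and, by \<open>dyadic_right\<close>, those of larger
  index have not begun; this makes the later sums over indices finite.\<close>

lemma dyadic_left:
  assumes "0 < t" "n < dyadic_index t"
  shows "dyadic_step n t = 1" "dyadic_tent n t = 0"
proof -
  have "2 * dyadic n \<le> t"
    using dyadic_mono[of "n + 1" "dyadic_index t"] dyadic_index_bounds(1)[OF assms(1)] assms(2)
    by (simp add: dyadic_Suc)
  then have "1 \<le> (t - dyadic n) / dyadic n"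
    by (simp add: le_divide_eq)
  then show "dyadic_step n t = 1" "dyadic_tent n t = 0"
    by (simp_all add: dyadic_step_def dyadic_tent_def)
qed

lemma dyadic_right:
  assumes "0 < t" "dyadic_index t < n"
  shows "dyadic_step n t = 0" "dyadic_tent n t = 0"
proof -
  have "t \<le> dyadic n"
    using dyadic_mono[of "dyadic_index t + 1" n] dyadic_index_bounds(2)[OF assms(1)] assms(2)
    by (simp add: dyadic_Suc)
  then have "(t - dyadic n) / dyadic n \<le> 0"
    by (simp add: divide_le_0_iff)
  then show "dyadic_step n t = 0" "dyadic_tent n t = 0"
    by (simp_all add: dyadic_step_def dyadic_tent_def)
qed

lemma dyadic_index_measurable: "dyadic_index \<in> measurable halfline (count_space UNIV)"
  unfolding dyadic_index_def [abs_def]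
  using borel_measurable_id_halfline by measurable

lemma borel_measurable_dyadic_index_step:
  "(\<lambda>t. dyadic_step (dyadic_index t) t) \<in> borel_measurable halfline"
  "(\<lambda>t. dyadic_tent (dyadic_index t) t) \<in> borel_measurable halfline"
proof -
  have d: "(\<lambda>t. dyadic (dyadic_index t)) \<in> borel_measurable halfline"
    by (rule measurable_compose[OF dyadic_index_measurable]) simp
  have s: "smooth_step \<in> borel_measurable borel" "tent \<in> borel_measurable borel"
    using DERIV_isCont[OF has_real_derivative_smooth_step] continuous_tent
    by (auto intro: borel_measurable_continuous_onI continuous_at_imp_continuous_on)
  have q: "(\<lambda>t. (t - dyadic (dyadic_index t)) / dyadic (dyadic_index t)) \<in> borel_measurable halfline"
    using d borel_measurable_id_halfline by measurable
  show "(\<lambda>t. dyadic_step (dyadic_index t) t) \<in> borel_measurable halfline"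
    unfolding dyadic_step_def by (rule measurable_compose[OF q s(1)])
  show "(\<lambda>t. dyadic_tent (dyadic_index t) t) \<in> borel_measurable halfline"
    unfolding dyadic_tent_def using measurable_compose[OF q s(2)] d by measurable
qed

section \<open>The smooth interpolation between dyadic decompositions\<close>

locale dyadic_decomposition = couple i j
  for i :: "'x::banach \<Rightarrow> 'v::{real_vector,topological_ab_group_add,t2_space}"
    and j :: "'y::banach \<Rightarrow> 'v" +
  fixes x :: 'v and a :: "int \<Rightarrow> 'x" and b :: "int \<Rightarrow> 'y"
  assumes decomposition: "i (a n) + j (b n) = x"
    and near_optimal: "norm (a n) + dyadic n * norm (b n) \<le> 2 * K (dyadic n) x"
begin

definition "d n = a n - a (n + 1)"

definition y :: "real \<Rightarrow> 'y" where
  "y t = (1 - dyadic_step (dyadic_index t) t) *\<^sub>R b (dyadic_index t) +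
     dyadic_step (dyadic_index t) t *\<^sub>R b (dyadic_index t + 1)"

text \<open>The derivative of \<open>y\<close> read in \<open>'x\<close>: the increment of
  \<open>b\<close> is replaced by \<open>d\<close>, which has the same image in the ambient space by
  \<open>i_d\<close>.\<close>

definition w :: "real \<Rightarrow> 'x" where
  "w t = dyadic_tent (dyadic_index t) t *\<^sub>R d (dyadic_index t)"

text \<open>The formula for \<open>y\<close> has no meaning at 0, where it involves
  \<open>log 2 0\<close>. The prescribed value \<open>x\<close> is shown to be the limit from the
  right in \<open>continuous_0\<close>.\<close>

definition u :: "real \<Rightarrow> 'v" where
  "u t = (if t \<le> 0 then x else j (y t))"

lemma x_mem: "x \<in> S"
  using decomposition by (rule sum_spaceI)

lemma i_d: "i (d n) = j (b (n + 1)) - j (b n)"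
  using decomposition[of n] decomposition[of "n + 1"]
  by (simp add: d_def embedding_simps algebra_simps)

lemma norm_a_le: "norm (a n) \<le> 2 * K (dyadic n) x"
  using near_optimal[of n] mult_nonneg_nonneg[OF dyadic_pos(2) norm_ge_zero, of n "b n"] by linarith

lemma norm_b_le: "norm (b n) \<le> 2 * K (dyadic n) x / dyadic n"
proof -
  have "dyadic n * norm (b n) \<le> 2 * K (dyadic n) x"
    using near_optimal[of n] norm_ge_zero[of "a n"] by linarith
  then show ?thesis by (simp add: le_divide_eq mult.commute)
qed

lemma K_dyadic_Suc_le: "K (dyadic (n + 1)) x \<le> 2 * K (dyadic n) x"
  using K_le_max[of "dyadic n" "dyadic (n + 1)" x] x_mem by (simp add: dyadic_Suc)

lemma K_dyadic_index_le: "0 < t \<Longrightarrow> K (dyadic (dyadic_index t)) x \<le> K t x"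
  using dyadic_index_bounds(1) by (intro K_mono x_mem) auto

lemma K_dyadic_index_div_le:
  assumes t: "0 < t"
  shows "K (dyadic (dyadic_index t)) x / dyadic (dyadic_index t) \<le> 2 * (K t x / t)"
proof -
  have "K (dyadic (dyadic_index t)) x / dyadic (dyadic_index t) \<le> K t x / (t / 2)"
    using K_dyadic_index_le[OF t] dyadic_index_bounds(2)[OF t] t K_nonneg[of t x] x_mem
    by (intro frac_le) auto
  then show ?thesis by (simp add: mult.commute)
qed

text \<open>The constant is \<open>(2 + 2) * 2\<close>: each of the two neighbouring vectors
  \<open>b\<close> contributes 2, by near optimality and doubling of \<open>K\<close>, and passing
  from the dyadic point to \<open>t\<close> costs another 2.\<close>

lemma norm_y_le:
  assumes t: "0 < t"
  shows "norm (y t) \<le> 8 * (K t x / t)"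
proof -
  let ?m = "dyadic_index t" and ?c = "dyadic_step (dyadic_index t) t"
  have "norm (y t) \<le> (1 - ?c) * norm (b ?m) + ?c * norm (b (?m + 1))"
    unfolding y_def using dyadic_step_bounds[of ?m t]
    by (intro norm_triangle_le) auto
  also have "\<dots> \<le> 1 * norm (b ?m) + 1 * norm (b (?m + 1))"
    using dyadic_step_bounds[of ?m t] by (intro add_mono mult_right_mono) auto
  also have "\<dots> \<le> 4 * (K (dyadic ?m) x / dyadic ?m)"
    using norm_b_le[of ?m] norm_b_le[of "?m + 1"] K_dyadic_Suc_le[of ?m]
      divide_right_mono[OF K_dyadic_Suc_le[of ?m], of "dyadic ?m"]
    by (simp add: dyadic_Suc)
  finally show ?thesis using K_dyadic_index_div_le[OF t] by simp
qed

lemma norm_a_index_le: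
  "0 < t \<Longrightarrow> norm (a (dyadic_index t)) + norm (a (dyadic_index t + 1)) \<le> 6 * K (dyadic (dyadic_index t)) x"
  using norm_a_le[of "dyadic_index t"] norm_a_le[of "dyadic_index t + 1"]
    K_dyadic_Suc_le[of "dyadic_index t"] by linarith

text \<open>The constant is \<open>2 * 6 * 2\<close>: the peak of the tent, the bound for two
  neighbouring vectors \<open>a\<close>, and the passage from the dyadic point to
  \<open>t\<close>.\<close>

lemma norm_w_le:
  assumes t: "0 < t"
  shows "norm (w t) \<le> 24 * (K t x / t)"
proof -
  let ?m = "dyadic_index t"
  have "norm (d ?m) \<le> 6 * K (dyadic ?m) x"
    using norm_a_index_le[OF t] norm_triangle_ineq4[of "a ?m" "a (?m + 1)"] by (simp add: d_def)
  then have "dyadic_tent ?m t * norm (d ?m) \<le> (2 / dyadic ?m) * (6 * K (dyadic ?m) x)"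
    using dyadic_tent_bounds[of ?m t] by (intro mult_mono) auto
  then have "norm (w t) \<le> (2 / dyadic ?m) * (6 * K (dyadic ?m) x)"
    using dyadic_tent_bounds[of ?m t] by (simp add: w_def)
  also have "\<dots> = 12 * (K (dyadic ?m) x / dyadic ?m)" by simp
  finally show ?thesis using K_dyadic_index_div_le[OF t] by simp
qed

lemma strongly_measurable_y: "strongly_measurable_in UNIV norm halfline y"
proof -
  interpret Y: seminormed UNIV "norm :: 'y \<Rightarrow> real"
    by unfold_locales (auto intro: norm_triangle_ineq)
  show ?thesis
    unfolding y_def [abs_def]
    using Y.strongly_measurable_in_piecewise[OF dyadic_index_measurable, of _ b]
      Y.strongly_measurable_in_piecewise[OF dyadic_index_measurable, of _ "\<lambda>n. b (n + 1)"]
      borel_measurable_dyadic_index_step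
    by (intro Y.strongly_measurable_in_add) auto
qed

lemma strongly_measurable_w: "strongly_measurable_in UNIV norm halfline w"
proof -
  interpret X: seminormed UNIV "norm :: 'x \<Rightarrow> real"
    by unfold_locales (auto intro: norm_triangle_ineq)
  show ?thesis
    unfolding w_def [abs_def] using borel_measurable_dyadic_index_step dyadic_index_measurable
    by (intro X.strongly_measurable_in_piecewise) auto
qed

lemma u_mem: "u t \<in> S"
  by (simp add: u_def x_mem embedding_mem)

lemma strongly_measurable_u: "strongly_measurable_in S (sum_norm i j) halfline u"
proof (rule n.strongly_measurable_in_cong_AE)
  let ?c = "\<lambda>t. dyadic_step (dyadic_index t) t"
  show "strongly_measurable_in S (sum_norm i j) halfline
      (\<lambda>t. (1 - ?c t) *\<^sub>R j (b (dyadic_index t)) + ?c t *\<^sub>R j (b (dyadic_index t + 1)))"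
    using n.strongly_measurable_in_piecewise[OF dyadic_index_measurable, of _ "\<lambda>n. j (b n)"]
      n.strongly_measurable_in_piecewise[OF dyadic_index_measurable, of _ "\<lambda>n. j (b (n + 1))"]
      borel_measurable_dyadic_index_step
    by (intro n.strongly_measurable_in_add) (auto simp: embedding_mem)
  show "AE t in halfline. (1 - ?c t) *\<^sub>R j (b (dyadic_index t)) + ?c t *\<^sub>R j (b (dyadic_index t + 1)) = u t"
    using AE_halfline_pos by eventually_elim (simp add: u_def y_def embedding_simps)
qed (use u_mem in auto)

lemma strongly_measurable_iw: "strongly_measurable_in S (sum_norm i j) halfline (\<lambda>t. i (w t))"
  unfolding w_def embedding_simps using borel_measurable_dyadic_index_step dyadic_index_measurable
  by (intro n.strongly_measurable_in_piecewise) (auto simp: embedding_mem)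

text \<open>Completed steps telescope to \<open>b\<close> at the current index. The right-hand sides
  use one index range for all \<open>t\<close> in a compact interval, which leaves scalar calculus
  with fixed vectors.\<close>

lemma representation:
  assumes t: "0 < t" and M: "M \<le> dyadic_index t" "dyadic_index t \<le> M'"
  shows "u t = j (b M) + (\<Sum>n\<in>{M..M'}. dyadic_step n t *\<^sub>R i (d n))"
    and "i (w t) = (\<Sum>n\<in>{M..M'}. dyadic_tent n t *\<^sub>R i (d n))"
proof -
  let ?m = "dyadic_index t"
  have split: "(\<Sum>n\<in>{M..M'}. f n) = (\<Sum>n\<in>{M..<?m}. f n) + f ?m"
    if "\<And>n. ?m < n \<Longrightarrow> f n = 0" for f :: "int \<Rightarrow> 'v"
  proof -
    have "(\<Sum>n\<in>{M..M'}. f n) = (\<Sum>n\<in>insert ?m {M..<?m}. f n)"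
      using M that by (intro sum.mono_neutral_right) (auto, metis linorder_less_linear)
    then show ?thesis by (simp add: add.commute)
  qed
  have "(\<Sum>n\<in>{M..M'}. dyadic_step n t *\<^sub>R i (d n)) =
      (\<Sum>n\<in>{M..<?m}. j (b (n + 1)) - j (b n)) + dyadic_step ?m t *\<^sub>R i (d ?m)"
    using dyadic_left[OF t] dyadic_right[OF t] by (subst split) (auto simp: i_d)
  then show "u t = j (b M) + (\<Sum>n\<in>{M..M'}. dyadic_step n t *\<^sub>R i (d n))"
    using t sum_telescope_int[OF M(1), of "\<lambda>n. j (b n)"]
    by (simp add: u_def y_def i_d embedding_simps algebra_simps)
  show "i (w t) = (\<Sum>n\<in>{M..M'}. dyadic_tent n t *\<^sub>R i (d n))"
    using dyadic_left[OF t] dyadic_right[OF t] by (subst split) (auto simp: w_def embedding_simps)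
qed

lemma weak_derivative: "weak_derivative_in S (sum_norm i j) u (\<lambda>t. i (w t))"
  unfolding weak_derivative_in_def
proof (intro allI impI)
  fix \<phi> \<phi>' assume \<phi>: "test_function \<phi> \<phi>'"
  then obtain A B where der: "\<And>t. (\<phi> has_real_derivative \<phi>' t) (at t)" and A: "0 < A"
    and supp: "\<And>t. t \<notin> {A..B} \<Longrightarrow> \<phi> t = 0"
    unfolding test_function_def by blast
  have supp': "\<phi>' t = 0" if "t \<notin> {A..B}" for t
    using test_function_derivative_outside[OF der supp that] .
  \<comment> \<open>The support of \<open>\<phi>\<close> stays away from 0, so this range is finite
    and serves every relevant \<open>t\<close>.\<close>
  define I where "I = {dyadic_index A..dyadic_index B}"
  let ?b = "b (dyadic_index A)"
  have rep: "u t = j ?b + (\<Sum>n\<in>I. dyadic_step n t *\<^sub>R i (d n))"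
    "i (w t) = (\<Sum>n\<in>I. dyadic_tent n t *\<^sub>R i (d n))" if "t \<in> {A..B}" for t
    using representation[of t "dyadic_index A" "dyadic_index B"] that A dyadic_index_mono
    unfolding I_def by auto
  note parts = integral_by_parts_test_function[OF \<phi> has_real_derivative_dyadic_step continuous_on_dyadic_tent]
  \<comment> \<open>Integration by parts against the constant 1: the term with the fixed vector
    \<open>j ?b\<close> drops out.\<close>
  have parts1: "integrable halfline \<phi>'" "(\<integral>t. \<phi>' t \<partial>halfline) = 0"
    using integral_by_parts_test_function[OF \<phi>, of "\<lambda>_. 1" "\<lambda>_. 0"] by simp_all
  let ?z = "(\<integral>t. \<phi>' t \<partial>halfline) *\<^sub>R j ?b + (\<Sum>n\<in>I. (\<integral>t. \<phi>' t * dyadic_step n t \<partial>halfline) *\<^sub>R i (d n))"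
  have "has_bochner_integral_in S (sum_norm i j) halfline
      (\<lambda>t. \<phi>' t *\<^sub>R j ?b + (\<Sum>n\<in>I. (\<phi>' t * dyadic_step n t) *\<^sub>R i (d n))) ?z"
    by (intro n.has_bochner_integral_in_add n.has_bochner_integral_in_scaleR
        n.has_bochner_integral_in_sum_scaleR complete_halfline parts parts1 embedding_mem)
  moreover have "\<phi>' t *\<^sub>R j ?b + (\<Sum>n\<in>I. (\<phi>' t * dyadic_step n t) *\<^sub>R i (d n)) = \<phi>' t *\<^sub>R u t" for t
    using rep(1)[of t] supp'[of t]
    by (cases "t \<in> {A..B}") (auto simp: scaleR_add_right scaleR_sum_right)
  ultimately have 1: "has_bochner_integral_in S (sum_norm i j) halfline (\<lambda>t. \<phi>' t *\<^sub>R u t) ?z"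
    by simp
  have "has_bochner_integral_in S (sum_norm i j) halfline
      (\<lambda>t. \<Sum>n\<in>I. (\<phi> t * dyadic_tent n t) *\<^sub>R i (d n))
      (\<Sum>n\<in>I. (\<integral>t. \<phi> t * dyadic_tent n t \<partial>halfline) *\<^sub>R i (d n))"
    by (intro n.has_bochner_integral_in_sum_scaleR complete_halfline parts embedding_mem)
  moreover have "(\<Sum>n\<in>I. (\<phi> t * dyadic_tent n t) *\<^sub>R i (d n)) = \<phi> t *\<^sub>R i (w t)" for t
    using rep(2)[of t] supp[of t]
    by (cases "t \<in> {A..B}") (auto simp: scaleR_sum_right)
  moreover have "(\<Sum>n\<in>I. (\<integral>t. \<phi> t * dyadic_tent n t \<partial>halfline) *\<^sub>R i (d n)) = - ?z"
    using parts(3) parts1 by (simp add: sum_negf)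
  ultimately show "\<exists>z. has_bochner_integral_in S (sum_norm i j) halfline (\<lambda>t. \<phi>' t *\<^sub>R u t) z \<and>
      has_bochner_integral_in S (sum_norm i j) halfline (\<lambda>t. \<phi> t *\<^sub>R i (w t)) (- z)"
    using 1 by (intro exI[of _ ?z]) simp
qed

text \<open>On the window from \<open>t / 2\<close> to \<open>2 * t\<close> the constant vector
  cancels and finitely many continuous scalar functions are left.\<close>

lemma continuous_pos:
  assumes t: "0 < t"
  shows "((\<lambda>s. sum_norm i j (u s - u t)) \<longlongrightarrow> 0) (at t within {0..})"
proof -
  define I where "I = {dyadic_index (t / 2)..dyadic_index (2 * t)}"
  have rep: "u s = j (b (dyadic_index (t / 2))) + (\<Sum>n\<in>I. dyadic_step n s *\<^sub>R i (d n))"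
    if "t / 2 \<le> s" "s \<le> 2 * t" for s
    using representation(1)[of s "dyadic_index (t / 2)" "dyadic_index (2 * t)"] that t dyadic_index_mono
    unfolding I_def by auto
  have "\<forall>\<^sub>F s in at t within {0..}. t / 2 < s \<and> s < 2 * t"
    using t by (intro eventually_conj order_tendstoD[OF tendsto_ident_at]) auto
  then have "\<forall>\<^sub>F s in at t within {0..}. norm (sum_norm i j (u s - u t)) \<le>
      (\<Sum>n\<in>I. \<bar>dyadic_step n s - dyadic_step n t\<bar> * sum_norm i j (i (d n)))"
  proof eventually_elim
    case (elim s)
    have "u s - u t = (\<Sum>n\<in>I. (dyadic_step n s - dyadic_step n t) *\<^sub>R i (d n))"
      using rep[of s] rep[of t] elim t by (simp add: scaleR_diff_left sum_subtractf)
    then have "sum_norm i j (u s - u t) \<le>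
        (\<Sum>n\<in>I. sum_norm i j ((dyadic_step n s - dyadic_step n t) *\<^sub>R i (d n)))"
      using n.sum_le[of I "\<lambda>n. (dyadic_step n s - dyadic_step n t) *\<^sub>R i (d n)"]
      by (simp add: embedding_mem)
    then show ?case
      using n.nonneg[of "u s - u t"] u_mem by (simp add: n.scale embedding_mem)
  qed
  note bound = this
  have lim: "(dyadic_step n \<longlongrightarrow> dyadic_step n t) (at t within {0..})" for n
    using DERIV_isCont[OF has_real_derivative_dyadic_step[of n t]]
    unfolding isCont_def by (rule tendsto_within_subset) simp
  have "((\<lambda>s. \<Sum>n\<in>I. \<bar>dyadic_step n s - dyadic_step n t\<bar> * sum_norm i j (i (d n)))
      \<longlongrightarrow> (\<Sum>n\<in>I. \<bar>dyadic_step n t - dyadic_step n t\<bar> * sum_norm i j (i (d n)))) (at t within {0..})"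
    by (intro tendsto_sum tendsto_mult_right tendsto_rabs tendsto_diff lim tendsto_const)
  then have "((\<lambda>s. \<Sum>n\<in>I. \<bar>dyadic_step n s - dyadic_step n t\<bar> * sum_norm i j (i (d n)))
      \<longlongrightarrow> 0) (at t within {0..})"
    by simp
  with bound show ?thesis
    by (rule Lim_null_comparison)
qed

text \<open>No finite representation reaches 0. Substituting \<open>x - i (a n)\<close> for
  \<open>j (b n)\<close> leaves only terms in the vectors \<open>a\<close>, whose norms are bounded
  by multiples of \<open>K s x\<close>.\<close>

lemma continuous_0:
  assumes "((\<lambda>t. K t x) \<longlongrightarrow> 0) (at_right 0)"
  shows "((\<lambda>s. sum_norm i j (u s - u 0)) \<longlongrightarrow> 0) (at 0 within {0..})"
proof (rule Lim_null_comparison)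
  have "\<forall>\<^sub>F s in at 0 within {0..}. 0 < (s::real)"
    by (auto simp: eventually_at_filter intro!: always_eventually)
  then show "\<forall>\<^sub>F s in at 0 within {0..}. norm (sum_norm i j (u s - u 0)) \<le> 6 * K s x"
  proof eventually_elim
    case (elim s)
    let ?m = "dyadic_index s" and ?c = "dyadic_step (dyadic_index s) s"
    have b: "j (b n) = x - i (a n)" for n
      using decomposition[of n] by (simp add: algebra_simps)
    have "u s - u 0 = (?c - 1) *\<^sub>R i (a ?m) - ?c *\<^sub>R i (a (?m + 1))"
      using elim by (simp add: u_def y_def embedding_simps b algebra_simps)
    also have "sum_norm i j \<dots> \<le> (1 - ?c) * sum_norm i j (i (a ?m)) + ?c * sum_norm i j (i (a (?m + 1)))"
      using n.triangle_diff[of "(?c - 1) *\<^sub>R i (a ?m)" "?c *\<^sub>R i (a (?m + 1))"] dyadic_step_bounds[of ?m s]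
      by (simp add: embedding_mem n.scale)
    also have "\<dots> \<le> 1 * norm (a ?m) + 1 * norm (a (?m + 1))"
      using dyadic_step_bounds[of ?m s] sum_norm_embedding_le(1) n.nonneg[OF embedding_mem(1)]
      by (intro add_mono mult_mono) auto
    also have "\<dots> \<le> 6 * K s x"
      using norm_a_index_le[OF elim] K_dyadic_index_le[OF elim] by simp
    finally show ?case
      using n.nonneg[of "u s - u 0"] u_mem by simp
  qed
  have "at 0 within {0..} = at_right (0::real)"
    unfolding at_within_def by (rule arg_cong[where f = "\<lambda>A. inf (nhds 0) (principal A)"]) auto
  then show "((\<lambda>s. 6 * K s x) \<longlongrightarrow> 0) (at 0 within {0..})"
    using tendsto_mult_left[OF assms, of 6] by simp
qed

end

section \<open>Membership in the trace space and equivalence of the norms\<close>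

context function_space_couple
begin

text \<open>Since \<open>K(t,x)/t\<close> is decreasing, \<open>K(\<tau>,x)\<close> is at most its integral over \<open>[0,\<tau>]\<close>.\<close>

lemma K_tendsto_0:
  assumes x: "x \<in> K_space \<Phi> i j"
  shows "((\<lambda>t. K t x) \<longlongrightarrow> 0) (at_right 0)"
proof -
  let ?k = "\<lambda>t. K t x / t"
  have xS: "x \<in> S" and k: "(\<lambda>t. complex_of_real (?k t)) \<in> \<Phi>"
    using x by (auto simp: K_space_def)
  have int: "integrable (lebesgue_on {0..\<tau>}) ?k" if "0 \<le> \<tau>" for \<tau>
    using k that by (rule integrable_real_Icc)
  have le: "K \<tau> x \<le> integral {0..\<tau>} ?k" if \<tau>: "0 < \<tau>" for \<tau>
  proof -
    have "(\<integral>t. ?k \<tau> \<partial>lebesgue_on {0..\<tau>}) \<le> (\<integral>t. ?k t \<partial>lebesgue_on {0..\<tau>})"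
    proof (rule integral_mono_AE)
      show "integrable (lebesgue_on {0..\<tau>}) (\<lambda>t. ?k \<tau>)"
        by (intro finite_measure.integrable_const finite_measure_lebesgue_on) simp
      show "integrable (lebesgue_on {0..\<tau>}) ?k"
        using \<tau> by (intro int) simp
      show "AE t in lebesgue_on {0..\<tau>}. ?k \<tau> \<le> ?k t"
        using AE_lebesgue_on_Icc_pos AE_space
      proof eventually_elim
        case (elim t)
        then have "K \<tau> x \<le> (\<tau> / t) * K t x"
          using K_le_max[of t \<tau> x] xS by (simp add: max_def split: if_splits)
        then show ?case using elim \<tau> by (simp add: field_simps)
      qed
    qed
    also have "(\<integral>t. ?k \<tau> \<partial>lebesgue_on {0..\<tau>}) = K \<tau> x"
      using \<tau> by (simp add: measure_restrict_space)
    also have "(\<integral>t. ?k t \<partial>lebesgue_on {0..\<tau>}) = integral {0..\<tau>} ?k"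
      using \<tau> by (intro lebesgue_integral_eq_integral int) auto
    finally show ?thesis .
  qed
  \<comment> \<open>Local integrability is used as continuity of the indefinite integral at
    0.\<close>
  have "continuous_on {0..1} (\<lambda>\<tau>. integral {0..\<tau>} ?k)"
    using int[of 1] by (intro indefinite_integral_continuous_1 integrable_on_lebesgue_on) auto
  then have "((\<lambda>\<tau>. integral {0..\<tau>} ?k) \<longlongrightarrow> integral {0..0} ?k) (at 0 within {0..1})"
    unfolding continuous_on_def by (rule bspec) simp
  then have lim: "((\<lambda>\<tau>. integral {0..\<tau>} ?k) \<longlongrightarrow> 0) (at_right 0)"
    by (simp add: at_within_Icc_at_right)
  show ?thesis
  proof (rule Lim_null_comparison[OF _ lim])
    show "\<forall>\<^sub>F t in at_right 0. norm (K t x) \<le> integral {0..t} ?k"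
      using eventually_at_right_less[of "0::real"]
      by eventually_elim (use le K_nonneg xS in auto)
  qed
qed

text \<open>For \<open>x = 0\<close> the zero decomposition is exact; otherwise \<open>K_pos\<close>
  leaves room between \<open>K\<close> and \<open>2 * K\<close>.\<close>

lemma near_optimal_decomposition:
  assumes x: "x \<in> S"
  obtains a b where "\<And>n. i (a n) + j (b n) = x"
    "\<And>n. norm (a n) + dyadic n * norm (b n) \<le> 2 * K (dyadic n) x"
proof (cases "x = 0")
  case True
  then show ?thesis
    using that[of "\<lambda>_. 0" "\<lambda>_. 0"] K_nonneg x by (simp add: embedding_simps)
next
  case False
  have "\<exists>a b. i a + j b = x \<and> norm a + dyadic n * norm b \<le> 2 * K (dyadic n) x" for n
    using K_approx[OF x, of "dyadic n" "2 * K (dyadic n) x"] K_pos[OF dyadic_pos(1) x False, of n]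
    by (metis less_imp_le mult_2 less_add_same_cancel1)
  then show ?thesis using that by metis
qed

text \<open>The constant is \<open>8 + 24\<close>, from \<open>norm_y_le\<close> and
  \<open>norm_w_le\<close>.\<close>

lemma K_space_W1_data:
  assumes x: "x \<in> K_space \<Phi> i j"
  shows "\<exists>u y w. W1_data \<Phi> i j u y w \<and> u 0 = x \<and>
    bochner_norm N y + bochner_norm N w \<le> 32 * K_norm N i j x"
proof -
  have xS: "x \<in> S" and k: "(\<lambda>t. complex_of_real (K t x / t)) \<in> \<Phi>"
    using x by (auto simp: K_space_def)
  obtain a b where "\<And>n. i (a n) + j (b n) = x"
    "\<And>n. norm (a n) + dyadic n * norm (b n) \<le> 2 * K (dyadic n) x"
    by (rule near_optimal_decomposition[OF xS]) (rule that)
  then interpret dyadic_decomposition i j x a b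
    by unfold_locales
  interpret Y: seminormed UNIV "norm :: 'y \<Rightarrow> real"
    by unfold_locales (auto intro: norm_triangle_ineq)
  interpret X: seminormed UNIV "norm :: 'x \<Rightarrow> real"
    by unfold_locales (auto intro: norm_triangle_ineq)
  \<comment> \<open>The ideal property for functions dominated by a multiple of
    \<open>K t x / t\<close>, used for \<open>norm (y t)\<close> with 8 and for
    \<open>norm (w t)\<close> with 24.\<close>
  have bound: "(\<lambda>t. complex_of_real (f t)) \<in> \<Phi> \<and> N (\<lambda>t. complex_of_real (f t)) \<le> c * K_norm N i j x"
    if f: "f \<in> borel_measurable halfline" and c: "0 \<le> c"
      and le: "\<And>t. 0 < t \<Longrightarrow> \<bar>f t\<bar> \<le> c * (K t x / t)" for f c
  proof -
    have "AE t in halfline. cmod (complex_of_real (f t)) \<le> cmod (complex_of_real c * complex_of_real (K t x / t))"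
      using AE_halfline_pos
    proof eventually_elim
      case (elim t)
      have "\<bar>f t\<bar> \<le> \<bar>c * (K t x / t)\<bar>"
        using le[OF elim] by linarith
      then show ?case
        by (simp only: norm_of_real flip: of_real_mult)
    qed
    moreover have "(\<lambda>t. complex_of_real (f t)) \<in> borel_measurable halfline"
      using f by measurable
    ultimately have "(\<lambda>t. complex_of_real (f t)) \<in> \<Phi>"
      "N (\<lambda>t. complex_of_real (f t)) \<le> N (\<lambda>t. complex_of_real c * complex_of_real (K t x / t))"
      using ideal[OF scale[OF k]] ideal_norm[OF scale[OF k]] by blast+
    then show ?thesis
      using norm_scale[OF k, of c] c by (simp add: K_norm_def)
  qed
  have y: "(\<lambda>t. complex_of_real (norm (y t))) \<in> \<Phi> \<and>
      N (\<lambda>t. complex_of_real (norm (y t))) \<le> 8 * K_norm N i j x"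
    using norm_y_le Y.strongly_measurable_in_borel_seminorm[OF strongly_measurable_y complete_halfline, of 1]
    by (intro bound) auto
  have w: "(\<lambda>t. complex_of_real (norm (w t))) \<in> \<Phi> \<and>
      N (\<lambda>t. complex_of_real (norm (w t))) \<le> 24 * K_norm N i j x"
    using norm_w_le X.strongly_measurable_in_borel_seminorm[OF strongly_measurable_w complete_halfline, of 1]
    by (intro bound) auto
  \<comment> \<open>Local integrability in the sum norm is inherited from members of
    \<open>\<Phi>\<close>, which are locally integrable because the Hardy operator is bounded on
    \<open>\<Phi>\<close>.\<close>
  have int: "integrable (lebesgue_on {0..\<tau>}) (\<lambda>t. sum_norm i j (f t))"
    if f: "strongly_measurable_in S (sum_norm i j) halfline f" and \<tau>: "0 \<le> \<tau>"
      and g: "(\<lambda>t. complex_of_real (g t)) \<in> \<Phi>" and le: "\<And>t. 0 < t \<Longrightarrow> sum_norm i j (f t) \<le> g t"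
    for f g \<tau>
  proof (rule Bochner_Integration.integrable_bound[OF integrable_real_Icc[OF g \<tau>]])
    show "(\<lambda>t. sum_norm i j (f t)) \<in> borel_measurable (lebesgue_on {0..\<tau>})"
      using n.strongly_measurable_in_borel_seminorm[OF f complete_halfline, of 1]
      by (intro borel_measurable_halfline_Icc) simp
    show "AE t in lebesgue_on {0..\<tau>}. norm (sum_norm i j (f t)) \<le> norm (g t)"
      using AE_lebesgue_on_Icc_pos
    proof eventually_elim
      case (elim t)
      then show ?case
        using le[OF elim] n.nonneg[OF n.strongly_measurable_in_mem[OF f, of t]] by simp
    qed
  qed
  have "W11_loc_in S (sum_norm i j) u (\<lambda>t. i (w t))"
    unfolding W11_loc_in_def locally_integrable_in_def
  proof (intro conjI allI impI)
    fix \<tau> :: real assume \<tau>: "0 \<le> \<tau>"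
    show "integrable (lebesgue_on {0..\<tau>}) (\<lambda>t. sum_norm i j (u t))"
      using y sum_norm_embedding_le(2)
      by (intro int[OF strongly_measurable_u \<tau>, of "\<lambda>t. norm (y t)"]) (auto simp: u_def)
    show "integrable (lebesgue_on {0..\<tau>}) (\<lambda>t. sum_norm i j (i (w t)))"
      using w sum_norm_embedding_le(1)
      by (intro int[OF strongly_measurable_iw \<tau>, of "\<lambda>t. norm (w t)"]) auto
    show "((\<lambda>s. sum_norm i j (u s - u \<tau>)) \<longlongrightarrow> 0) (at \<tau> within {0..})"
      using continuous_pos continuous_0[OF K_tendsto_0[OF x]] \<tau> by (cases "\<tau> = 0") auto
  qed (rule strongly_measurable_u strongly_measurable_iw weak_derivative)+
  moreover have "AE t in halfline. u t = j (y t)"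
    using AE_halfline_pos by eventually_elim (simp add: u_def)
  ultimately have "W1_data \<Phi> i j u y w"
    using y w strongly_measurable_y strongly_measurable_w by (simp add: W1_data_def bochner_space_def)
  moreover have "u 0 = x"
    by (simp add: u_def)
  moreover have "bochner_norm N y + bochner_norm N w \<le> 32 * K_norm N i j x"
    using y w by (simp add: bochner_norm_def)
  ultimately show ?thesis by blast
qed

lemma trace_space_eq_K_space: "trace_space \<Phi> i j = K_space \<Phi> i j"
proof -
  obtain C where "\<And>f. f \<in> \<Phi> \<Longrightarrow> N (hardy f) \<le> C * N f"
    using hardy_bounded by (auto simp: hardy_bounded_on_def)
  then show ?thesis
    using trace_mem_K_space K_space_W1_data unfolding trace_space_def by blast
qed

lemma bochner_norm_nonneg: "f \<in> bochner_space \<Phi> \<Longrightarrow> 0 \<le> bochner_norm N f"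
  by (simp add: bochner_space_def bochner_norm_def norm_nonneg)

lemma trace_norm_le_K_norm:
  assumes "x \<in> K_space \<Phi> i j"
  shows "trace_norm \<Phi> N i j x \<le> 32 * K_norm N i j x"
proof -
  obtain u y w where data: "W1_data \<Phi> i j u y w" "u 0 = x"
    and le: "bochner_norm N y + bochner_norm N w \<le> 32 * K_norm N i j x"
    using K_space_W1_data[OF assms] by blast
  have "trace_norm \<Phi> N i j x \<le> bochner_norm N y + bochner_norm N w"
    unfolding trace_norm_def
  proof (rule cInf_lower)
    show "bdd_below {bochner_norm N y + bochner_norm N w |u y w. W1_data \<Phi> i j u y w \<and> u 0 = x}"
      by (rule bdd_belowI[of _ 0]) (auto simp: W1_data_def intro!: add_nonneg_nonneg bochner_norm_nonneg)
  qed (use data in blast)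
  then show ?thesis using le by simp
qed

text \<open>\<open>max C 1\<close> dominates the coefficients \<open>C\<close> of the derivative and
  1 of the function itself, and is positive whatever the sign of \<open>C\<close>, so it can be
  divided out before passing to the infimum.\<close>

lemma K_norm_le_trace_norm:
  assumes C: "\<And>f. f \<in> \<Phi> \<Longrightarrow> N (hardy f) \<le> C * N f" and x: "x \<in> trace_space \<Phi> i j"
  shows "K_norm N i j x \<le> max C 1 * trace_norm \<Phi> N i j x"
proof -
  have "K_norm N i j x / max C 1 \<le> trace_norm \<Phi> N i j x"
    unfolding trace_norm_def
  proof (rule cInf_greatest)
    show "{bochner_norm N y + bochner_norm N w |u y w. W1_data \<Phi> i j u y w \<and> u 0 = x} \<noteq> {}"
      using x unfolding trace_space_def by blast
    fix r assume "r \<in> {bochner_norm N y + bochner_norm N w |u y w. W1_data \<Phi> i j u y w \<and> u 0 = x}"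
    then obtain u y w where r: "r = bochner_norm N y + bochner_norm N w"
      and data: "W1_data \<Phi> i j u y w" "u 0 = x" by blast
    have nonneg: "0 \<le> bochner_norm N y" "0 \<le> bochner_norm N w"
      using data by (auto simp: W1_data_def intro: bochner_norm_nonneg)
    have "K_norm N i j x \<le> C * bochner_norm N w + 1 * bochner_norm N y"
      using K_norm_trace_le[OF C data(1)] data(2) by simp
    also have "\<dots> \<le> max C 1 * bochner_norm N w + max C 1 * bochner_norm N y"
      using nonneg by (intro add_mono mult_right_mono) auto
    finally show "K_norm N i j x / max C 1 \<le> r"
      by (simp add: r divide_le_eq algebra_simps)
  qed
  moreover have "0 < max C 1" by simp
  ultimately show ?thesis by (simp only: pos_divide_le_eq mult.commute)
qed

end

theorem theorem2p3:
  fixes \<Phi> :: "(real \<Rightarrow> complex) set"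
    and N :: "(real \<Rightarrow> complex) \<Rightarrow> real"
    and i :: "'x::banach \<Rightarrow> 'v::{real_vector,topological_ab_group_add,t2_space}"
    and j :: "'y::banach \<Rightarrow> 'v"
  assumes "banach_function_space \<Phi> N"
    and "hardy_bounded_on \<Phi> N"
    and "interpolation_couple i j"
  shows "equal_with_equivalent_norms
           (trace_space \<Phi> i j) (trace_norm \<Phi> N i j) (K_space \<Phi> i j) (K_norm N i j)"
proof -
  interpret function_space_couple i j \<Phi> N
    using assms by unfold_locales
  obtain C where C: "\<And>f. f \<in> \<Phi> \<Longrightarrow> N (hardy f) \<le> C * N f"
    using assms(2) by (auto simp: hardy_bounded_on_def)
  have "(1 / max C 1) * K_norm N i j x \<le> trace_norm \<Phi> N i j x \<and>
      trace_norm \<Phi> N i j x \<le> 32 * K_norm N i j x" if "x \<in> trace_space \<Phi> i j" for x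
    using K_norm_le_trace_norm[OF C that] trace_norm_le_K_norm[of x] that
    by (simp add: trace_space_eq_K_space divide_le_eq mult.commute)
  moreover have "0 < 1 / max C 1"
    by simp
  ultimately show ?thesis
    unfolding equal_with_equivalent_norms_def trace_space_eq_K_space
    by (metis zero_less_numeral)
qed

end
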